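(* Let $p>2$ be a prime and let $D$ be the Fraïssé limit of the class $\mathbb{K}_{2,p}^P$. Then in $\mathrm{Th}(D)$ the formula $\varphi(x;y_1,y_2,y_3)$ given by $[x,y_1]=[y_2,y_3]$ has the tree property of the second kind (TP$_2$).
   Context: $\mathbb{G}_{2,p}$ is the variety of groups of nilpotency class at most 2 satisfying $x^p=1$, in the language $L$ of group theory. $L_P$ is $L$ together with a unary predicate $P$. $\mathbb{G}_{2,p}^P$ is the class of $L_P$-structures $G$ whose underlying group is in $\mathbb{G}_{2,p}$ and in which $P(G)$ is a subgroup with $G'\subseteq P(G)\subseteq Z(G)$, where $G'$ is the commutator subgroup and $Z(G)$ the center; morphisms are $L_P$-embeddings. $\mathbb{K}_{2,p}^P$ is the class of finite structures in $\mathbb{G}_{2,p}^P$; it is known to have the hereditary, joint embedding and amalgamation properties, and $D$ denotes its (countable) Fraïssé limit. $[x,y]$ denotes the group commutator. A formula $\varphi(x;\bar y)$ has TP$_2$ in a complete theory $T$ if in some model of $T$ there is an array of parameter tuples $(\bar a_{\alpha,i})_{\alpha<\omega,\,i<\omega}$ and some $k\ge 2$ such that for each $\alpha$ the set $\{\varphi(x;\bar a_{\alpha,i}):i<\omega\}$ is $k$-inconsistent, while for every $f:\omega\to\omega$ the set $\{\varphi(x;\bar a_{\alpha,f(\alpha)}):\alpha<\omega\}$ is consistent. *)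

theory Defs
  imports "HOL-Algebra.Generated_Groups" "HOL-Computational_Algebra.Primes" "HOL-Library.Countable_Set"
begin

section \<open>Structures for the language of groups with a unary predicate\<close>

text \<open>The inverse is a symbol of the language, interpreted by an arbitrary unary operation; it is
  required to be the group inverse only for the members of the class of groups considered below.\<close>

record 'a lp_struct = "'a monoid" +
  inv_op :: "'a \<Rightarrow> 'a"
  predP :: "'a set"

definition lp_structure :: "'a lp_struct \<Rightarrow> bool" where
  "lp_structure M \<longleftrightarrow>
     \<one>\<^bsub>M\<^esub> \<in> carrier M \<and>
     (\<forall>x\<in>carrier M. \<forall>y\<in>carrier M. x \<otimes>\<^bsub>M\<^esub> y \<in> carrier M) \<and>
     (\<forall>x\<in>carrier M. inv_op M x \<in> carrier M) \<and>
     predP M \<subseteq> carrier M"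

definition lp_embedding :: "('a \<Rightarrow> 'b) \<Rightarrow> 'a lp_struct \<Rightarrow> 'b lp_struct \<Rightarrow> bool" where
  "lp_embedding h M N \<longleftrightarrow>
     h ` carrier M \<subseteq> carrier N \<and> inj_on h (carrier M) \<and>
     h \<one>\<^bsub>M\<^esub> = \<one>\<^bsub>N\<^esub> \<and>
     (\<forall>x\<in>carrier M. \<forall>y\<in>carrier M. h (x \<otimes>\<^bsub>M\<^esub> y) = h x \<otimes>\<^bsub>N\<^esub> h y) \<and>
     (\<forall>x\<in>carrier M. h (inv_op M x) = inv_op N (h x)) \<and>
     (\<forall>x\<in>carrier M. h x \<in> predP N \<longleftrightarrow> x \<in> predP M)"

definition lp_iso :: "('a \<Rightarrow> 'b) \<Rightarrow> 'a lp_struct \<Rightarrow> 'b lp_struct \<Rightarrow> bool" where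
  "lp_iso h M N \<longleftrightarrow> lp_embedding h M N \<and> h ` carrier M = carrier N"

inductive_set lp_generated :: "'a lp_struct \<Rightarrow> 'a set \<Rightarrow> 'a set"
  for M :: "'a lp_struct" and S :: "'a set" where
  incl: "x \<in> S \<Longrightarrow> x \<in> lp_generated M S"
| one: "\<one>\<^bsub>M\<^esub> \<in> lp_generated M S"
| mult: "x \<in> lp_generated M S \<Longrightarrow> y \<in> lp_generated M S \<Longrightarrow> x \<otimes>\<^bsub>M\<^esub> y \<in> lp_generated M S"
| inverse: "x \<in> lp_generated M S \<Longrightarrow> inv_op M x \<in> lp_generated M S"

definition lp_substructure :: "'a lp_struct \<Rightarrow> 'a set \<Rightarrow> 'a lp_struct" where
  "lp_substructure M A = M\<lparr>carrier := A, predP := predP M \<inter> A\<rparr>"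

definition finitely_generated :: "'a lp_struct \<Rightarrow> bool" where
  "finitely_generated M \<longleftrightarrow>
     (\<exists>S. finite S \<and> S \<subseteq> carrier M \<and> carrier M = lp_generated M S)"


section \<open>First-order formulas\<close>

datatype lp_term = Var nat | One | Mult lp_term lp_term | Inv lp_term

datatype lp_form =
    Eq lp_term lp_term
  | InP lp_term
  | Neg lp_form
  | Conj lp_form lp_form
  | Ex nat lp_form

primrec eval_term :: "'a lp_struct \<Rightarrow> (nat \<Rightarrow> 'a) \<Rightarrow> lp_term \<Rightarrow> 'a" where
  "eval_term M v (Var n) = v n"
| "eval_term M v One = \<one>\<^bsub>M\<^esub>"
| "eval_term M v (Mult s t) = eval_term M v s \<otimes>\<^bsub>M\<^esub> eval_term M v t"
| "eval_term M v (Inv t) = inv_op M (eval_term M v t)"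

primrec sat :: "'a lp_struct \<Rightarrow> (nat \<Rightarrow> 'a) \<Rightarrow> lp_form \<Rightarrow> bool" where
  "sat M v (Eq s t) \<longleftrightarrow> eval_term M v s = eval_term M v t"
| "sat M v (InP t) \<longleftrightarrow> eval_term M v t \<in> predP M"
| "sat M v (Neg \<phi>) \<longleftrightarrow> \<not> sat M v \<phi>"
| "sat M v (Conj \<phi> \<psi>) \<longleftrightarrow> sat M v \<phi> \<and> sat M v \<psi>"
| "sat M v (Ex n \<phi>) \<longleftrightarrow> (\<exists>x\<in>carrier M. sat M (v(n := x)) \<phi>)"

primrec term_vars :: "lp_term \<Rightarrow> nat set" where
  "term_vars (Var n) = {n}"
| "term_vars One = {}"
| "term_vars (Mult s t) = term_vars s \<union> term_vars t"
| "term_vars (Inv t) = term_vars t"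

primrec free_vars :: "lp_form \<Rightarrow> nat set" where
  "free_vars (Eq s t) = term_vars s \<union> term_vars t"
| "free_vars (InP t) = term_vars t"
| "free_vars (Neg \<phi>) = free_vars \<phi>"
| "free_vars (Conj \<phi> \<psi>) = free_vars \<phi> \<union> free_vars \<psi>"
| "free_vars (Ex n \<phi>) = free_vars \<phi> - {n}"

definition assignment :: "'a lp_struct \<Rightarrow> (nat \<Rightarrow> 'a) \<Rightarrow> bool" where
  "assignment M v \<longleftrightarrow> (\<forall>n. v n \<in> carrier M)"

definition Th :: "'a lp_struct \<Rightarrow> lp_form set" where
  "Th M = {\<phi>. free_vars \<phi> = {} \<and> (\<forall>v. assignment M v \<longrightarrow> sat M v \<phi>)}"

definition models :: "'a lp_struct \<Rightarrow> lp_form set \<Rightarrow> bool" where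
  "models M T \<longleftrightarrow>
     lp_structure M \<and> (\<forall>\<phi>\<in>T. \<forall>v. assignment M v \<longrightarrow> sat M v \<phi>)"

definition elementary_embedding :: "('a \<Rightarrow> 'b) \<Rightarrow> 'a lp_struct \<Rightarrow> 'b lp_struct \<Rightarrow> bool" where
  "elementary_embedding h M N \<longleftrightarrow>
     h ` carrier M \<subseteq> carrier N \<and>
     (\<forall>\<phi> v. assignment M v \<longrightarrow> (sat N (h \<circ> v) \<phi> \<longleftrightarrow> sat M v \<phi>))"


section \<open>The tree property of the second kind\<close>

text \<open>The instance of a formula \<open>\<phi>\<close> at a parameter tuple is the pair of \<open>\<phi>\<close> and an assignment
  \<open>a\<close>: the tuple is the restriction of \<open>a\<close> to the free variables of \<open>\<phi>\<close> other than the
  object variable \<open>x\<close>, and the remaining values of \<open>a\<close> are irrelevant. A set of such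
  instances over \<open>M\<close> is consistent if it is realised in an elementary extension of \<open>M\<close>, i.e.
  satisfiable together with the elementary diagram of \<open>M\<close>.

  Since HOL cannot quantify over types inside a formula, the models here are the countable ones,
  represented on arbitrary subsets of the natural numbers. The language is countable and only
  countably many parameters occur, so by the downward Loewenheim-Skolem theorem this restriction
  is harmless, both for the model carrying the array and for its elementary extensions.\<close>

definition consistent_over :: "nat lp_struct \<Rightarrow> nat \<Rightarrow> (lp_form \<times> (nat \<Rightarrow> nat)) set \<Rightarrow> bool" where
  "consistent_over M x \<Phi> \<longleftrightarrow>
     (\<exists>(N :: nat lp_struct) h b.
        lp_structure N \<and> elementary_embedding h M N \<and> b \<in> carrier N \<and>
        (\<forall>(\<phi>, a)\<in>\<Phi>. sat N ((h \<circ> a)(x := b)) \<phi>))"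

text \<open>Inconsistency of a row is a property of the indexed family, not of its set of values: a
  constant row would otherwise be vacuously 2-inconsistent.\<close>

definition k_inconsistent ::
  "nat \<Rightarrow> nat lp_struct \<Rightarrow> nat \<Rightarrow> (nat \<Rightarrow> lp_form \<times> (nat \<Rightarrow> nat)) \<Rightarrow> bool" where
  "k_inconsistent k M x \<Phi> \<longleftrightarrow>
     (\<forall>I. finite I \<and> card I = k \<longrightarrow> \<not> consistent_over M x (\<Phi> ` I))"

definition has_TP2 :: "lp_form set \<Rightarrow> lp_form \<Rightarrow> nat \<Rightarrow> bool" where
  "has_TP2 T \<phi> x \<longleftrightarrow>
     (\<exists>(M :: nat lp_struct) (a :: nat \<Rightarrow> nat \<Rightarrow> nat \<Rightarrow> nat) k.
        models M T \<and> (\<forall>\<alpha> i. assignment M (a \<alpha> i)) \<and> k \<ge> 2 \<and>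
        (\<forall>\<alpha>. k_inconsistent k M x (\<lambda>i. (\<phi>, a \<alpha> i))) \<and>
        (\<forall>f :: nat \<Rightarrow> nat. consistent_over M x (range (\<lambda>\<alpha>. (\<phi>, a \<alpha> (f \<alpha>))))))"


section \<open>Fraisse limits\<close>

text \<open>Finitely generated structures are countable, so an isomorphism-closed class of them is
  determined by its members carried by subsets of the natural numbers.\<close>

definition age :: "'a lp_struct \<Rightarrow> nat lp_struct set" where
  "age M = {A. lp_structure A \<and> finitely_generated A \<and> (\<exists>h. lp_embedding h A M)}"

definition ultrahomogeneous :: "'a lp_struct \<Rightarrow> bool" where
  "ultrahomogeneous M \<longleftrightarrow>
     (\<forall>S T h. finite S \<and> S \<subseteq> carrier M \<and> finite T \<and> T \<subseteq> carrier M \<and>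
        lp_iso h (lp_substructure M (lp_generated M S)) (lp_substructure M (lp_generated M T)) \<longrightarrow>
        (\<exists>g. lp_iso g M M \<and> (\<forall>x\<in>lp_generated M S. g x = h x)))"

definition fraisse_limit :: "nat lp_struct set \<Rightarrow> 'a lp_struct \<Rightarrow> bool" where
  "fraisse_limit K D \<longleftrightarrow>
     lp_structure D \<and> countable (carrier D) \<and> ultrahomogeneous D \<and> age D = K"


section \<open>Class 2 groups of exponent p with a central predicate\<close>

definition group_center :: "('a, 'b) monoid_scheme \<Rightarrow> 'a set" where
  "group_center G = {z \<in> carrier G. \<forall>x\<in>carrier G. z \<otimes>\<^bsub>G\<^esub> x = x \<otimes>\<^bsub>G\<^esub> z}"

definition commutator :: "('a, 'b) monoid_scheme \<Rightarrow> 'a \<Rightarrow> 'a \<Rightarrow> 'a" where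
  "commutator G x y = inv\<^bsub>G\<^esub> x \<otimes>\<^bsub>G\<^esub> inv\<^bsub>G\<^esub> y \<otimes>\<^bsub>G\<^esub> x \<otimes>\<^bsub>G\<^esub> y"

text \<open>Indexed from 0: \<open>lower_central G c\<close> is the term usually written with index \<open>c + 1\<close>.\<close>

primrec lower_central :: "('a, 'b) monoid_scheme \<Rightarrow> nat \<Rightarrow> 'a set" where
  "lower_central G 0 = carrier G"
| "lower_central G (Suc n) =
     generate G {commutator G x y | x y. x \<in> lower_central G n \<and> y \<in> carrier G}"

definition nilpotency_class_le :: "('a, 'b) monoid_scheme \<Rightarrow> nat \<Rightarrow> bool" where
  "nilpotency_class_le G c \<longleftrightarrow> lower_central G c = {\<one>\<^bsub>G\<^esub>}"

definition in_variety_G2p :: "nat \<Rightarrow> ('a, 'b) monoid_scheme \<Rightarrow> bool" where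
  "in_variety_G2p p G \<longleftrightarrow>
     group G \<and> nilpotency_class_le G 2 \<and> (\<forall>x\<in>carrier G. x [^]\<^bsub>G\<^esub> p = \<one>\<^bsub>G\<^esub>)"

text \<open>\<open>derived G (carrier G)\<close> is the commutator subgroup. The library forms it from the
  commutators of inverses, which generate the same subgroup.\<close>

definition in_G2pP :: "nat \<Rightarrow> 'a lp_struct \<Rightarrow> bool" where
  "in_G2pP p G \<longleftrightarrow>
     lp_structure G \<and> in_variety_G2p p G \<and> (\<forall>x\<in>carrier G. inv_op G x = inv\<^bsub>G\<^esub> x) \<and>
     subgroup (predP G) G \<and>
     derived G (carrier G) \<subseteq> predP G \<and> predP G \<subseteq> group_center G"

definition K2pP :: "nat \<Rightarrow> nat lp_struct set" where
  "K2pP p = {G. in_G2pP p G \<and> finite (carrier G)}"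


section \<open>The formula\<close>

definition Comm :: "lp_term \<Rightarrow> lp_term \<Rightarrow> lp_term" where
  "Comm s t = Mult (Mult (Mult (Inv s) (Inv t)) s) t"

text \<open>The object variable is \<open>Var 0\<close>; the parameter variables are \<open>Var 1\<close>, \<open>Var 2\<close>, \<open>Var 3\<close>.\<close>

definition comm_formula :: lp_form where
  "comm_formula = Eq (Comm (Var 0) (Var 1)) (Comm (Var 2) (Var 3))"

end

theory Submission
  imports Defs "HOL-Number_Theory.Cong"
begin

text \<open>Every countable structure in \<open>\<G>\<close>, the class whose finite members form the Fraisse class, embeds
  in \<open>D\<close>, and every embedding of \<open>D\<close> into itself is elementary: on finitely many elements it agrees
  with an automorphism. So it is enough to extend \<open>D\<close> inside \<open>\<G>\<close>.

  The rows are \<open>[x, b\<^sub>\<alpha>] = [c, d\<^sub>\<alpha>\<^sub>i]\<close> with \<open>b\<^sub>\<alpha>\<close> independent modulo \<open>P\<close> and the commutators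
  \<open>[c, d\<^sub>\<alpha>\<^sub>i]\<close> pairwise distinct, so each row is 2-inconsistent. For a path \<open>f\<close>, a homomorphism
  \<open>\<phi> : D \<rightarrow> P(D)\<close> that kills \<open>P(D)\<close> and sends \<open>b\<^sub>\<alpha>\<close> to \<open>[c, d\<^sub>\<alpha>\<^sub>f\<^sub>(\<^sub>\<alpha>\<^sub>)]\<close> exists by
  linear algebra over the field with \<open>p\<close> elements, and the extension of \<open>D\<close> by an element \<open>x\<close> of
  order \<open>p\<close> with \<open>[x, m] = \<phi>(m)\<close> realises the path.\<close>


section \<open>Universal axioms\<close>

text \<open>A proper elementary extension cannot be avoided. An element of \<open>D\<close>
  satisfies the instances of at most one path, since two paths differ in some row and rows are
  2-inconsistent, whereas \<open>D\<close> is countable and there are uncountably many paths. The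
  extension used is \<open>D\<close> again, over a self-embedding chosen for the path, so all
  conditions of a path are met at once, without compactness or quantifier elimination.

  The homomorphism takes values in \<open>P(D)\<close> because commutators lie there, and kills
  \<open>P(D)\<close> because \<open>x\<close> must commute with it. Thus it lives on
  \<open>D/P(D)\<close>, where independence of the \<open>b\<close> parameters lets its values be
  prescribed freely.

  Oddness of \<open>p\<close> gives both the group carrying the array and the extension by
  \<open>x\<close> exponent \<open>p\<close>: their power formulas contain the binomial coefficient
  \<open>n choose 2\<close>, which \<open>p\<close> divides at \<open>n = p\<close>.

  Local finiteness makes the span of a finite subset of any structure in the class a finite
  structure, hence one that embeds in \<open>D\<close>; homogeneity then glues such embeddings along
  a chain.\<close>

definition G2pP_laws :: "nat \<Rightarrow> 'a lp_struct \<Rightarrow> bool" where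
  "G2pP_laws p M \<longleftrightarrow> lp_structure M \<and>
     (\<forall>x\<in>carrier M. \<forall>y\<in>carrier M. \<forall>z\<in>carrier M. x \<otimes>\<^bsub>M\<^esub> y \<otimes>\<^bsub>M\<^esub> z = x \<otimes>\<^bsub>M\<^esub> (y \<otimes>\<^bsub>M\<^esub> z)) \<and>
     (\<forall>x\<in>carrier M. \<one>\<^bsub>M\<^esub> \<otimes>\<^bsub>M\<^esub> x = x \<and> inv_op M x \<otimes>\<^bsub>M\<^esub> x = \<one>\<^bsub>M\<^esub> \<and> x [^]\<^bsub>M\<^esub> p = \<one>\<^bsub>M\<^esub>) \<and>
     \<one>\<^bsub>M\<^esub> \<in> predP M \<and>
     (\<forall>x\<in>predP M. inv_op M x \<in> predP M \<and>
        (\<forall>y\<in>predP M. x \<otimes>\<^bsub>M\<^esub> y \<in> predP M) \<and>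
        (\<forall>y\<in>carrier M. x \<otimes>\<^bsub>M\<^esub> y = y \<otimes>\<^bsub>M\<^esub> x)) \<and>
     (\<forall>x\<in>carrier M. \<forall>y\<in>carrier M.
        inv_op M x \<otimes>\<^bsub>M\<^esub> inv_op M y \<otimes>\<^bsub>M\<^esub> x \<otimes>\<^bsub>M\<^esub> y \<in> predP M)"

locale G2pP =
  fixes p :: nat and M :: "'a lp_struct" (structure)
  assumes laws: "G2pP_laws p M"
begin

lemma lp_structure_M: "lp_structure M"
  using laws by (simp add: G2pP_laws_def)

sublocale group M
proof (rule groupI)
  fix x assume "x \<in> carrier M"
  then show "\<exists>y\<in>carrier M. y \<otimes> x = \<one>"
    using laws unfolding G2pP_laws_def lp_structure_def by blast
qed (use laws in \<open>auto simp: G2pP_laws_def lp_structure_def\<close>)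

lemma inv_op_eq [simp]: "x \<in> carrier M \<Longrightarrow> inv_op M x = inv x"
  using laws lp_structure_M by (intro inv_equality[symmetric]) (auto simp: G2pP_laws_def lp_structure_def)

lemma pow_p [simp]: "x \<in> carrier M \<Longrightarrow> x [^] p = \<one>"
  using laws by (simp add: G2pP_laws_def)

lemma P_carrier [simp]: "x \<in> predP M \<Longrightarrow> x \<in> carrier M"
  using laws by (auto simp: G2pP_laws_def lp_structure_def)

lemma P_one [simp]: "\<one> \<in> predP M"
  using laws by (simp add: G2pP_laws_def)

lemma P_mult [simp]: "x \<in> predP M \<Longrightarrow> y \<in> predP M \<Longrightarrow> x \<otimes> y \<in> predP M"
  using laws by (simp add: G2pP_laws_def)

lemma P_inv [simp]: "x \<in> predP M \<Longrightarrow> inv x \<in> predP M"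
  using laws inv_op_eq[OF P_carrier, of x] by (auto simp: G2pP_laws_def)

lemma P_pow [simp]: "x \<in> predP M \<Longrightarrow> x [^] (n::nat) \<in> predP M"
  by (induction n) auto

lemma P_central: "x \<in> predP M \<Longrightarrow> y \<in> carrier M \<Longrightarrow> x \<otimes> y = y \<otimes> x"
  using laws unfolding G2pP_laws_def by blast

lemma commutator_P:
  "x \<in> carrier M \<Longrightarrow> y \<in> carrier M \<Longrightarrow> inv x \<otimes> inv y \<otimes> x \<otimes> y \<in> predP M"
  using laws by (auto simp: G2pP_laws_def)

lemma commute_P:
  assumes "x \<in> carrier M" "y \<in> carrier M"
  obtains c where "c \<in> predP M" "x \<otimes> y = y \<otimes> x \<otimes> c"
proof
  show "inv x \<otimes> inv y \<otimes> x \<otimes> y \<in> predP M" using assms by (rule commutator_P)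
  show "x \<otimes> y = y \<otimes> x \<otimes> (inv x \<otimes> inv y \<otimes> x \<otimes> y)"
    using assms by (simp add: m_assoc inv_solve_left') (simp flip: m_assoc)
qed

lemma P_left_commute:
  "c \<in> predP M \<Longrightarrow> x \<in> carrier M \<Longrightarrow> y \<in> carrier M \<Longrightarrow> x \<otimes> (c \<otimes> y) = c \<otimes> (x \<otimes> y)"
  by (metis P_carrier P_central m_assoc)

lemma in_G2pP: "in_G2pP p M"
proof -
  have sub: "subgroup (predP M) M"
    by (rule subgroupI) (auto, metis P_one empty_iff)
  have der: "derived M (carrier M) \<subseteq> predP M"
    unfolding derived_def
  proof (rule generate_subgroup_incl[OF _ sub], clarsimp)
    fix x y assume "x \<in> carrier M" "y \<in> carrier M"
    then show "x \<otimes> y \<otimes> inv x \<otimes> inv y \<in> predP M"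
      using commutator_P[of "inv x" "inv y"] by simp
  qed
  have lc1: "lower_central M (Suc 0) \<subseteq> predP M"
    unfolding lower_central.simps commutator_def
    by (rule generate_subgroup_incl[OF _ sub]) (use commutator_P in blast)
  \<comment> \<open>\<open>lower_central\<close> is indexed from 0, so class at most 2 concerns
    commutators of \<open>lower_central M (Suc 0)\<close>, already inside \<open>predP M\<close>,
    with all of \<open>M\<close>; centrality of \<open>predP M\<close> kills them.\<close>
  have trivial: "commutator M x y = \<one>" if "x \<in> predP M" "y \<in> carrier M" for x y
  proof -
    have "commutator M x y = inv y \<otimes> (inv x \<otimes> x) \<otimes> y"
      using that P_central[of "inv x" "inv y"] by (simp add: commutator_def m_assoc del: l_inv)
    then show ?thesis using that by simp
  qed
  have "\<one> \<in> lower_central M (Suc 0)"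
    by (simp add: generate.one)
  then have "{commutator M x y |x y. x \<in> lower_central M (Suc 0) \<and> y \<in> carrier M} = {\<one>}"
    using trivial lc1 by (auto simp del: lower_central.simps) (metis one_closed trivial P_one)
  then have "nilpotency_class_le M 2"
    unfolding nilpotency_class_le_def numeral_2_eq_2
    by (subst lower_central.simps(2)) (simp add: generate_one del: lower_central.simps)
  then show ?thesis
    using lp_structure_M sub der is_group P_central
    by (auto simp: in_G2pP_def in_variety_G2p_def group_center_def)
qed

end

text \<open>Replaces generated subgroups and the derived inverse by universal conditions in the
  symbols of the language. This form passes to substructures, needs only three elements at a time,
  and can be checked directly in concrete models.\<close>

lemma in_G2pP_iff_laws: "in_G2pP p M \<longleftrightarrow> G2pP_laws p M"
proof
  assume M: "in_G2pP p M"
  then interpret group M by (simp add: in_G2pP_def in_variety_G2p_def)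
  have inv: "inv_op M x = inv\<^bsub>M\<^esub> x" if "x \<in> carrier M" for x
    using M that by (simp add: in_G2pP_def)
  have sub: "subgroup (predP M) M" using M by (simp add: in_G2pP_def)
  have comm: "inv\<^bsub>M\<^esub> x \<otimes>\<^bsub>M\<^esub> inv\<^bsub>M\<^esub> y \<otimes>\<^bsub>M\<^esub> x \<otimes>\<^bsub>M\<^esub> y \<in> predP M"
    if "x \<in> carrier M" "y \<in> carrier M" for x y
  proof -
    \<comment> \<open>\<open>derived\<close> is generated by products \<open>x y x^-1 y^-1\<close>;
      inserting the inverses of \<open>x\<close> and \<open>y\<close> gives the commutator in the
      form used here.\<close>
    have "inv\<^bsub>M\<^esub> x \<otimes>\<^bsub>M\<^esub> inv\<^bsub>M\<^esub> y \<otimes>\<^bsub>M\<^esub> inv\<^bsub>M\<^esub> (inv\<^bsub>M\<^esub> x) \<otimes>\<^bsub>M\<^esub> inv\<^bsub>M\<^esub> (inv\<^bsub>M\<^esub> y)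
      \<in> derived M (carrier M)"
      unfolding derived_def by (rule generate.incl) (use that in blast)
    then show ?thesis using that M by (auto simp: in_G2pP_def)
  qed
  have "inv_op M x \<in> predP M" if "x \<in> predP M" for x
    using that inv subgroup.m_inv_closed[OF sub] subgroup.mem_carrier[OF sub] by simp
  with M show "G2pP_laws p M"
    using comm subgroup.one_closed[OF sub] subgroup.m_closed[OF sub]
    by (auto simp: G2pP_laws_def in_G2pP_def in_variety_G2p_def group_center_def inv m_assoc)
next
  assume "G2pP_laws p M"
  then show "in_G2pP p M" by (intro G2pP.in_G2pP G2pP.intro)
qed


section \<open>Embeddings, substructures and copies\<close>

lemma lp_structure_pow:
  assumes "lp_structure M" "x \<in> carrier M"
  shows "x [^]\<^bsub>M\<^esub> (n::nat) \<in> carrier M"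
  using assms by (induction n) (auto simp: nat_pow_def lp_structure_def)

text \<open>Powers are defined by recursion on the product alone, so no group axioms are required.
  This matters in \<open>laws_embedding\<close>, where \<open>M\<close> is not yet known to be a
  group.\<close>

lemma lp_embedding_pow:
  assumes "lp_structure M" "lp_embedding h M N" "x \<in> carrier M"
  shows "h (x [^]\<^bsub>M\<^esub> (n::nat)) = h x [^]\<^bsub>N\<^esub> n"
proof (induction n)
  case (Suc n)
  then show ?case
    using assms lp_structure_pow[OF assms(1,3), of n]
    by (simp add: nat_pow_def lp_embedding_def)
qed (use assms in \<open>simp add: nat_pow_def lp_embedding_def\<close>)

text \<open>Universal axioms are inherited by substructures: injectivity pulls the equations back,
  and the equivalence for \<open>predP\<close> in \<open>lp_embedding\<close> pulls the membership
  conditions back.\<close>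

lemma laws_embedding:
  assumes "lp_structure M" "lp_embedding h M N" "G2pP_laws p N"
  shows "G2pP_laws p M"
proof -
  have pow: "h (x [^]\<^bsub>M\<^esub> p) = h x [^]\<^bsub>N\<^esub> p" "x [^]\<^bsub>M\<^esub> p \<in> carrier M" if "x \<in> carrier M" for x
    using lp_embedding_pow[OF assms(1,2) that] lp_structure_pow[OF assms(1) that] by simp_all
  have inj: "h x = h y \<longleftrightarrow> x = y" if "x \<in> carrier M" "y \<in> carrier M" for x y
    using assms(2) that by (auto simp: lp_embedding_def inj_on_def)
  have C: "h x \<in> carrier N" if "x \<in> carrier M" for x
    using assms(2) that by (auto simp: lp_embedding_def)
  have P: "x \<in> predP M \<longleftrightarrow> x \<in> carrier M \<and> h x \<in> predP N" for x
    using assms(1,2) by (auto simp: lp_embedding_def lp_structure_def)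
  have cl: "\<one>\<^bsub>M\<^esub> \<in> carrier M" "\<And>x y. x \<in> carrier M \<Longrightarrow> y \<in> carrier M \<Longrightarrow> x \<otimes>\<^bsub>M\<^esub> y \<in> carrier M"
    "\<And>x. x \<in> carrier M \<Longrightarrow> inv_op M x \<in> carrier M"
    using assms(1) by (auto simp: lp_structure_def)
  have hom: "h \<one>\<^bsub>M\<^esub> = \<one>\<^bsub>N\<^esub>"
    "\<And>x y. x \<in> carrier M \<Longrightarrow> y \<in> carrier M \<Longrightarrow> h (x \<otimes>\<^bsub>M\<^esub> y) = h x \<otimes>\<^bsub>N\<^esub> h y"
    "\<And>x. x \<in> carrier M \<Longrightarrow> h (inv_op M x) = inv_op N (h x)"
    using assms(2) by (auto simp: lp_embedding_def)
  have "\<forall>x\<in>predP N. \<forall>y\<in>carrier N. x \<otimes>\<^bsub>N\<^esub> y = y \<otimes>\<^bsub>N\<^esub> x"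
    using assms(3) unfolding G2pP_laws_def by blast
  then have comm: "\<forall>x. x \<in> carrier M \<and> h x \<in> predP N \<longrightarrow>
      (\<forall>y. y \<in> carrier M \<longrightarrow> h x \<otimes>\<^bsub>N\<^esub> h y = h y \<otimes>\<^bsub>N\<^esub> h x)"
    using C by blast
  show ?thesis
    using assms(1,3) unfolding G2pP_laws_def
    by (simp add: P cl hom inj[symmetric] pow C Ball_def) (rule comm)
qed

lemma lp_embedding_carrier: "lp_embedding h M N \<Longrightarrow> x \<in> carrier M \<Longrightarrow> h x \<in> carrier N"
  by (auto simp: lp_embedding_def)

lemma lp_embedding_comp:
  assumes "lp_embedding h A B" "lp_embedding k B C"
  shows "lp_embedding (k \<circ> h) A C"
  using assms unfolding lp_embedding_def
  by (auto simp: image_subset_iff intro: comp_inj_on inj_on_subset)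

lemma lp_iso_comp:
  assumes "lp_iso h A B" "lp_iso k B C"
  shows "lp_iso (k \<circ> h) A C"
  using assms lp_embedding_comp unfolding lp_iso_def by (metis image_comp)

lemma lp_iso_inverse:
  assumes "lp_iso h A B" "lp_structure A"
  shows "lp_iso (the_inv_into (carrier A) h) B A"
proof -
  let ?g = "the_inv_into (carrier A) h"
  have inj: "inj_on h (carrier A)" and im: "h ` carrier A = carrier B"
    using assms(1) by (auto simp: lp_iso_def lp_embedding_def)
  have gh: "?g (h x) = x" if "x \<in> carrier A" for x
    using inj that by (rule the_inv_into_f_f)
  have "?g ` carrier B = carrier A"
    using gh by (auto simp: im[symmetric] image_image)
  moreover have "inj_on ?g (carrier B)"
    using gh by (auto simp: im[symmetric] inj_on_def)
  moreover have "?g \<one>\<^bsub>B\<^esub> = \<one>\<^bsub>A\<^esub>"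
    using gh assms by (metis lp_embedding_def lp_iso_def lp_structure_def)
  moreover have "?g (x \<otimes>\<^bsub>B\<^esub> y) = ?g x \<otimes>\<^bsub>A\<^esub> ?g y" if "x \<in> h ` carrier A" "y \<in> h ` carrier A" for x y
  proof -
    from that obtain a b where ab: "a \<in> carrier A" "b \<in> carrier A" "x = h a" "y = h b"
      by blast
    then have "x \<otimes>\<^bsub>B\<^esub> y = h (a \<otimes>\<^bsub>A\<^esub> b)" "a \<otimes>\<^bsub>A\<^esub> b \<in> carrier A"
      using assms by (auto simp: lp_embedding_def lp_iso_def lp_structure_def)
    then show ?thesis using ab by (simp add: gh)
  qed
  moreover have "?g (inv_op B x) = inv_op A (?g x)" "?g x \<in> predP A \<longleftrightarrow> x \<in> predP B"
    if "x \<in> h ` carrier A" for x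
  proof -
    from that obtain a where a: "a \<in> carrier A" "x = h a"
      by blast
    then have "inv_op B x = h (inv_op A a)" "inv_op A a \<in> carrier A"
      using assms by (auto simp: lp_embedding_def lp_iso_def lp_structure_def)
    then show "?g (inv_op B x) = inv_op A (?g x)" using a by (simp add: gh)
    show "?g x \<in> predP A \<longleftrightarrow> x \<in> predP B"
      using a assms(1) by (simp add: gh lp_iso_def lp_embedding_def)
  qed
  ultimately show ?thesis
    unfolding lp_iso_def lp_embedding_def im[symmetric] by simp
qed

section \<open>Generated substructures and their images under embeddings\<close>

lemma lp_generated_subset:
  assumes "lp_structure M" "S \<subseteq> carrier M"
  shows "lp_generated M S \<subseteq> carrier M"
proof
  fix x assume "x \<in> lp_generated M S"
  then show "x \<in> carrier M"
    by induction (use assms in \<open>auto simp: lp_structure_def\<close>)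
qed

lemma lp_generated_mono: "S \<subseteq> T \<Longrightarrow> lp_generated M S \<subseteq> lp_generated M T"
proof
  fix x assume "S \<subseteq> T" "x \<in> lp_generated M S"
  from this(2,1) show "x \<in> lp_generated M T"
    by induction (auto intro: lp_generated.intros)
qed

lemma lp_substructure_simps [simp]:
  "carrier (lp_substructure M A) = A" "predP (lp_substructure M A) = predP M \<inter> A"
  "monoid.mult (lp_substructure M A) = monoid.mult M" "monoid.one (lp_substructure M A) = monoid.one M"
  "inv_op (lp_substructure M A) = inv_op M"
  by (simp_all add: lp_substructure_def)

abbreviation lp_span :: "'a lp_struct \<Rightarrow> 'a set \<Rightarrow> 'a lp_struct" where
  "lp_span M S \<equiv> lp_substructure M (lp_generated M S)"

lemma lp_structure_span: "lp_structure (lp_span M S)"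
  by (auto simp: lp_structure_def intro: lp_generated.intros)

lemma lp_generated_span: "lp_generated (lp_span M S) S = lp_generated M S"
proof (intro equalityI subsetI)
  fix x assume "x \<in> lp_generated (lp_span M S) S"
  then show "x \<in> lp_generated M S"
    by induction (auto intro: lp_generated.intros)
next
  fix x assume "x \<in> lp_generated M S"
  then show "x \<in> lp_generated (lp_span M S) S"
  proof induction
    case one
    then show ?case using lp_generated.one[of "lp_span M S" S] by simp
  next
    case (mult x y)
    then show ?case using lp_generated.mult[of _ "lp_span M S" S] by simp
  next
    case (inverse x)
    then show ?case using lp_generated.inverse[of _ "lp_span M S" S] by simp
  qed (rule lp_generated.incl)
qed

lemma lp_embedding_restrict:
  assumes "lp_embedding h M N" "A \<subseteq> carrier M"
  shows "lp_embedding h (lp_substructure M A) N"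
proof -
  have "inj_on h A" using assms by (auto simp: lp_embedding_def intro: inj_on_subset)
  with assms show ?thesis by (auto simp: lp_embedding_def subset_iff)
qed

lemma lp_embedding_id: "lp_embedding (\<lambda>x. x) M M"
  by (auto simp: lp_embedding_def)

lemma lp_embedding_generated:
  assumes "lp_structure M" "lp_embedding h M N" "S \<subseteq> carrier M"
  shows "h ` lp_generated M S = lp_generated N (h ` S)"
proof (intro equalityI subsetI)
  fix y assume "y \<in> h ` lp_generated M S"
  then obtain x where x: "x \<in> lp_generated M S" "y = h x" by blast
  have "x \<in> carrier M \<and> h x \<in> lp_generated N (h ` S)"
    using x(1)
    by induction (use assms in \<open>auto simp: lp_embedding_def lp_structure_def intro: lp_generated.intros\<close>)
  then show "y \<in> lp_generated N (h ` S)" using x by simp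
next
  note sub = lp_generated_subset[OF assms(1,3), THEN subsetD]
  fix y assume "y \<in> lp_generated N (h ` S)"
  then show "y \<in> h ` lp_generated M S"
  proof induction
    case one
    have "\<one>\<^bsub>N\<^esub> = h \<one>\<^bsub>M\<^esub>" using assms(2) by (simp add: lp_embedding_def)
    then show ?case using lp_generated.one by (rule image_eqI)
  next
    case (mult x y)
    then obtain a b where ab: "a \<in> lp_generated M S" "x = h a" "b \<in> lp_generated M S" "y = h b"
      by blast
    then have "x \<otimes>\<^bsub>N\<^esub> y = h (a \<otimes>\<^bsub>M\<^esub> b)"
      using assms(2) sub by (simp add: lp_embedding_def)
    then show ?case using lp_generated.mult[OF ab(1,3)] by (rule image_eqI)
  next
    case (inverse x)
    then obtain a where a: "a \<in> lp_generated M S" "x = h a" by blast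
    then have "inv_op N x = h (inv_op M a)"
      using assms(2) sub by (simp add: lp_embedding_def)
    then show ?case using lp_generated.inverse[OF a(1)] by (rule image_eqI)
  qed (auto intro: lp_generated.incl)
qed

lemma lp_iso_span:
  assumes "lp_structure M" "lp_embedding h M N" "S \<subseteq> carrier M"
  shows "lp_iso h (lp_span M S) (lp_span N (h ` S))"
proof -
  have "lp_embedding h (lp_span M S) N"
    using assms lp_embedding_restrict lp_generated_subset by blast
  then show ?thesis
    using lp_embedding_generated[OF assms]
    unfolding lp_iso_def lp_embedding_def by auto
qed

section \<open>Transport of structure along an injection\<close>

definition lp_copy :: "('a \<Rightarrow> 'b) \<Rightarrow> 'a lp_struct \<Rightarrow> 'b lp_struct" where
  "lp_copy f M =
     \<lparr>carrier = f ` carrier M,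
      monoid.mult = (\<lambda>x y. f (the_inv_into (carrier M) f x \<otimes>\<^bsub>M\<^esub> the_inv_into (carrier M) f y)),
      one = f \<one>\<^bsub>M\<^esub>,
      inv_op = (\<lambda>x. f (inv_op M (the_inv_into (carrier M) f x))), predP = f ` predP M\<rparr>"

lemma lp_copy:
  assumes "lp_structure M" "inj_on f (carrier M)"
  shows "lp_structure (lp_copy f M)" "lp_iso f M (lp_copy f M)"
proof -
  note inv = the_inv_into_f_f[OF assms(2)]
  show "lp_structure (lp_copy f M)"
    using assms(1) by (auto simp: lp_structure_def lp_copy_def inv)
  show "lp_iso f M (lp_copy f M)"
    using assms inj_on_image_mem_iff[OF assms(2), of _ "predP M"]
    unfolding lp_structure_def lp_iso_def lp_embedding_def by (simp add: lp_copy_def inv)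
qed

text \<open>\<open>age\<close>, \<open>K2pP\<close> and \<open>has_TP2\<close> speak only of
  structures on \<open>nat\<close>, while \<open>D\<close> and the auxiliary groups live on other
  types; this is the passage between them.\<close>

lemma countable_copy:
  assumes "lp_structure M" "countable (carrier M)"
  obtains f and N :: "nat lp_struct" where "lp_structure N" "lp_iso f M N"
  using lp_copy[OF assms(1), of "to_nat_on (carrier M)"] assms(2) that by blast


section \<open>First-order formulas under isomorphisms\<close>

lemma eval_term_cong: "\<forall>n\<in>term_vars t. v n = w n \<Longrightarrow> eval_term M v t = eval_term M w t"
  by (induction t) auto

lemma sat_cong: "\<forall>n\<in>free_vars \<phi>. v n = w n \<Longrightarrow> sat M v \<phi> \<longleftrightarrow> sat M w \<phi>"
proof (induction \<phi> arbitrary: v w)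
  case (Eq s t)
  then have "eval_term M v s = eval_term M w s" "eval_term M v t = eval_term M w t"
    by (auto intro!: eval_term_cong)
  then show ?case by simp
next
  case (InP t)
  then show ?case by (metis eval_term_cong free_vars.simps(2) sat.simps(2))
next
  case (Neg \<phi>)
  then show ?case by (metis free_vars.simps(3) sat.simps(3))
next
  case (Conj \<phi> \<psi>)
  then have "sat M v \<phi> \<longleftrightarrow> sat M w \<phi>" "sat M v \<psi> \<longleftrightarrow> sat M w \<psi>"
    by (metis UnCI free_vars.simps(4))+
  then show ?case by simp
next
  case (Ex n \<phi>)
  have "sat M (v(n := x)) \<phi> \<longleftrightarrow> sat M (w(n := x)) \<phi>" for x
    using Ex.prems by (intro Ex.IH) auto
  then show ?case by simp
qed

lemma eval_term_embedding:
  assumes "lp_structure M" "lp_embedding h M N" "assignment M v"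
  shows "eval_term M v t \<in> carrier M \<and> eval_term N (h \<circ> v) t = h (eval_term M v t)"
  by (induction t) (use assms in \<open>auto simp: lp_structure_def lp_embedding_def assignment_def\<close>)

lemma sat_iso:
  assumes "lp_structure M" "lp_iso h M N" "assignment M v"
  shows "sat N (h \<circ> v) \<phi> \<longleftrightarrow> sat M v \<phi>"
  using assms(3)
proof (induction \<phi> arbitrary: v)
  case (Eq s t)
  have emb: "lp_embedding h M N" using assms(2) by (simp add: lp_iso_def)
  then have "inj_on h (carrier M)" by (simp add: lp_embedding_def)
  then show ?case
    using eval_term_embedding[OF assms(1) emb Eq] by (simp only: sat.simps inj_on_eq_iff)
next
  case (InP t)
  have emb: "lp_embedding h M N" using assms(2) by (simp add: lp_iso_def)
  then show ?case
    using eval_term_embedding[OF assms(1) emb InP] unfolding lp_embedding_def by (simp only: sat.simps)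
next
  case (Ex n \<phi>)
  have "assignment M (v(n := x))" if "x \<in> carrier M" for x
    using Ex.prems that by (simp add: assignment_def)
  then have "sat N ((h \<circ> v)(n := h x)) \<phi> \<longleftrightarrow> sat M (v(n := x)) \<phi>" if "x \<in> carrier M" for x
    using Ex.IH[of "v(n := x)"] that by (simp only: fun_upd_comp)
  moreover have "carrier N = h ` carrier M"
    using assms(2) by (simp add: lp_iso_def)
  ultimately show ?case by (simp only: sat.simps bex_simps(7)) blast
qed simp_all

lemma finite_term_vars: "finite (term_vars t)"
  by (induction t) auto

lemma finite_free_vars: "finite (free_vars \<phi>)"
  by (induction \<phi>) (auto simp: finite_term_vars)

lemma ultrahomogeneous_elementary:
  assumes "ultrahomogeneous D" "lp_structure D" "lp_embedding h D D"
  shows "elementary_embedding h D D"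
  unfolding elementary_embedding_def
proof (intro conjI allI impI)
  show "h ` carrier D \<subseteq> carrier D" using assms(3) by (simp add: lp_embedding_def)
  fix \<phi> v assume v: "assignment D v"
  \<comment> \<open>The assignment has infinitely many values, but only those at the finitely many
    free variables matter, which brings it within reach of homogeneity.\<close>
  define S where "S = v ` free_vars \<phi>"
  have S: "finite S" "S \<subseteq> carrier D"
    using v by (auto simp: S_def finite_free_vars assignment_def)
  have hS: "finite (h ` S)" "h ` S \<subseteq> carrier D"
    using S assms(3) by (auto simp: lp_embedding_def)
  obtain g where g: "lp_iso g D D" "\<forall>x\<in>lp_generated D S. g x = h x"
    using assms(1)[unfolded ultrahomogeneous_def, rule_format, of S "h ` S" h]
      S hS lp_iso_span[OF assms(2,3) S(2)] by auto
  have "sat D (h \<circ> v) \<phi> \<longleftrightarrow> sat D (g \<circ> v) \<phi>"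
    by (rule sat_cong) (use g(2) in \<open>auto simp: S_def lp_generated.incl\<close>)
  then show "sat D (h \<circ> v) \<phi> \<longleftrightarrow> sat D v \<phi>"
    using sat_iso[OF assms(2) g(1) v] by simp
qed

section \<open>Local finiteness\<close>

locale G2pP_prime = G2pP +
  assumes prime: "prime p"
begin

lemma inv_eq_pow: "x \<in> carrier M \<Longrightarrow> inv x = x [^] (p - 1)"
  using pow_p[of x] prime_gt_0_nat[OF prime]
  by (intro inv_equality) (simp_all flip: nat_pow_Suc)

text \<open>Inverses are powers in exponent \<open>p\<close>, so a subset closed under products is
  automatically a subgroup.\<close>

lemma inv_mem:
  assumes "K \<subseteq> carrier M" "\<one> \<in> K" "\<And>x y. x \<in> K \<Longrightarrow> y \<in> K \<Longrightarrow> x \<otimes> y \<in> K" "x \<in> K"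
  shows "inv x \<in> K"
proof -
  have "x [^] n \<in> K" for n :: nat
    using assms by (induction n) auto
  then show ?thesis using assms by (metis inv_eq_pow subsetD)
qed

lemma pow_mod_p: "x \<in> carrier M \<Longrightarrow> x [^] (n mod p) = x [^] (n::nat)"
proof -
  assume x: "x \<in> carrier M"
  have "x [^] n = (x [^] p) [^] (n div p) \<otimes> x [^] (n mod p)"
    using x by (simp add: nat_pow_pow nat_pow_mult del: pow_p)
  then show ?thesis using x by simp
qed

lemma pow_multiple_p: "x \<in> carrier M \<Longrightarrow> p dvd n \<Longrightarrow> x [^] (n::nat) = \<one>"
  using pow_mod_p[of x n] by (simp add: dvd_eq_mod_eq_0)

lemma finite_powers: "x \<in> carrier M \<Longrightarrow> finite (range (\<lambda>n::nat. x [^] n))"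
proof -
  assume x: "x \<in> carrier M"
  have "range (\<lambda>n::nat. x [^] n) \<subseteq> (\<lambda>n. x [^] n) ` {..<p}"
    using prime_gt_0_nat[OF prime] pow_mod_p[OF x]
    by (metis imageI image_subsetI lessThan_iff mod_less_divisor)
  then show ?thesis by (rule finite_subset) simp
qed

text \<open>The commutators of \<open>a\<close> with the elements of \<open>H\<close> form a finite central set
  \<open>T\<close> closed under products, because \<open>h \<mapsto> [h, a]\<close> is a homomorphism.\<close>

lemma finite_closure_insert:
  assumes H: "finite H" "H \<subseteq> carrier M" "\<one> \<in> H" "\<And>x y. x \<in> H \<Longrightarrow> y \<in> H \<Longrightarrow> x \<otimes> y \<in> H"
    and a: "a \<in> carrier M"
  obtains K where "finite K" "K \<subseteq> carrier M" "\<one> \<in> K"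
    "\<And>x y. x \<in> K \<Longrightarrow> y \<in> K \<Longrightarrow> x \<otimes> y \<in> K" "H \<subseteq> K" "a \<in> K"
proof
  define T where "T = {c \<in> predP M. \<exists>h\<in>H. a \<otimes> h = h \<otimes> a \<otimes> c}"
  \<comment> \<open>Normal forms: moving \<open>a [^] i\<close> to the right past an element of
    \<open>H\<close> costs a factor from \<open>T\<close>, which is central, so products of such
    forms can be brought to this form again.\<close>
  define K where "K = {h \<otimes> a [^] i \<otimes> t | h i t. h \<in> H \<and> t \<in> T \<and> i \<in> (UNIV :: nat set)}"
  have T1: "\<one> \<in> T" using H a by (auto simp: T_def intro!: bexI[of _ \<one>])
  have Tm: "c \<otimes> d \<in> T" if "c \<in> T" "d \<in> T" for c d
  proof -
    from that obtain h k where h: "h \<in> H" "k \<in> H" "a \<otimes> h = h \<otimes> a \<otimes> c" "a \<otimes> k = k \<otimes> a \<otimes> d"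
      and P: "c \<in> predP M" "d \<in> predP M"
      by (auto simp: T_def)
    have hk: "h \<in> carrier M" "k \<in> carrier M" using h H by auto
    have "a \<otimes> (h \<otimes> k) = (h \<otimes> a \<otimes> c) \<otimes> k"
      using hk a by (simp flip: h(3) add: m_assoc)
    also have "\<dots> = h \<otimes> (a \<otimes> k) \<otimes> c"
      using hk a P P_central[of c k] by (simp add: m_assoc)
    also have "\<dots> = h \<otimes> k \<otimes> a \<otimes> (c \<otimes> d)"
      using hk a P P_central[of c d] by (simp add: h(4) m_assoc)
    finally show ?thesis using P h H(4) by (auto simp: T_def)
  qed
  have TP: "T \<subseteq> predP M" by (auto simp: T_def)
  have pow: "\<exists>t\<in>T. a [^] i \<otimes> h = h \<otimes> a [^] i \<otimes> t" if "h \<in> H" for i :: nat and h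
  proof (induction i)
    case 0
    then show ?case using that H a T1 by (auto intro!: bexI[of _ \<one>])
  next
    case (Suc i)
    then obtain t where t: "t \<in> T" "a [^] i \<otimes> h = h \<otimes> a [^] i \<otimes> t" by blast
    have h: "h \<in> carrier M" using that H by auto
    obtain c where c: "c \<in> predP M" "a \<otimes> h = h \<otimes> a \<otimes> c" using commute_P[OF a h] .
    then have "c \<in> T" using that by (auto simp: T_def)
    have t': "t \<in> predP M" using t TP by blast
    have "a [^] Suc i \<otimes> h = a [^] i \<otimes> h \<otimes> a \<otimes> c"
      using a h c by (simp add: m_assoc)
    also have "\<dots> = h \<otimes> a [^] Suc i \<otimes> (t \<otimes> c)"
      using a h c(1) t' P_central[of t a] P_left_commute[of t a c] by (simp add: t(2) m_assoc)
    finally show ?case using Tm[OF t(1) \<open>c \<in> T\<close>] by blast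
  qed
  \<comment> \<open>A member of \<open>T\<close> is determined by the \<open>h\<close> witnessing
    it, so \<open>T\<close> is finite even when \<open>predP M\<close> is infinite.\<close>
  have "T \<subseteq> (\<lambda>h. inv (h \<otimes> a) \<otimes> (a \<otimes> h)) ` H"
  proof
    fix c assume "c \<in> T"
    then obtain h where h: "h \<in> H" "a \<otimes> h = h \<otimes> a \<otimes> c" "c \<in> predP M" by (auto simp: T_def)
    then have "h \<in> carrier M" using H by auto
    then have "c = inv (h \<otimes> a) \<otimes> (a \<otimes> h)"
      using h a by (simp add: h(2) flip: m_assoc) (simp add: m_assoc)
    then show "c \<in> (\<lambda>h. inv (h \<otimes> a) \<otimes> (a \<otimes> h)) ` H" using h(1) by blast
  qed
  then have "finite T" using H(1) finite_surj by blast
  have "K \<subseteq> (\<lambda>(h, b, t). h \<otimes> b \<otimes> t) ` (H \<times> range (\<lambda>n::nat. a [^] n) \<times> T)"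
    by (force simp: K_def)
  then show "finite K"
    using H(1) \<open>finite T\<close> finite_powers[OF a] by (meson finite_SigmaI finite_surj)
  show "K \<subseteq> carrier M"
    using H(2) TP a by (auto simp: K_def subset_iff)
  have HK: "h \<in> K" if "h \<in> H" for h
  proof -
    have "h = h \<otimes> a [^] (0::nat) \<otimes> \<one>" using that H(2) by auto
    then show ?thesis using that T1 unfolding K_def by blast
  qed
  then show "H \<subseteq> K" "\<one> \<in> K" using H(3) by auto
  have "a = \<one> \<otimes> a [^] (1::nat) \<otimes> \<one>" using a by simp
  then show "a \<in> K" using H(3) T1 unfolding K_def by blast
  show "x \<otimes> y \<in> K" if "x \<in> K" "y \<in> K" for x y
  proof -
    from that obtain h i t k j u where x: "x = h \<otimes> a [^] (i::nat) \<otimes> t" "h \<in> H" "t \<in> T"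
      and y: "y = k \<otimes> a [^] (j::nat) \<otimes> u" "k \<in> H" "u \<in> T"
      unfolding K_def by blast
    obtain s where s: "s \<in> T" "a [^] i \<otimes> k = k \<otimes> a [^] i \<otimes> s" using pow[OF y(2)] by blast
    have c: "h \<in> carrier M" "k \<in> carrier M" "t \<in> predP M" "u \<in> predP M" "s \<in> predP M"
      using x y s H TP by auto
    have "x \<otimes> y = h \<otimes> (a [^] i \<otimes> k) \<otimes> a [^] j \<otimes> (t \<otimes> u)"
      using a c by (simp add: x y m_assoc P_left_commute[of t])
    also have "\<dots> = (h \<otimes> k) \<otimes> (a [^] i \<otimes> a [^] j) \<otimes> (s \<otimes> (t \<otimes> u))"
      using a c by (simp add: s(2) m_assoc P_left_commute[of s])
    also have "\<dots> = (h \<otimes> k) \<otimes> a [^] (i + j) \<otimes> (s \<otimes> (t \<otimes> u))"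
      using a by (simp add: nat_pow_mult)
    finally show ?thesis
      using Tm s(1) x(2,3) y(2,3) H(4) unfolding K_def by blast
  qed
qed

text \<open>Adding one generator at a time keeps a finite set closed under products, and such a set
  is closed under inverses by \<open>inv_mem\<close>.\<close>

lemma finite_generated:
  assumes "finite S" "S \<subseteq> carrier M"
  shows "finite (lp_generated M S)"
proof -
  have "\<exists>K. finite K \<and> K \<subseteq> carrier M \<and> \<one> \<in> K \<and> (\<forall>x\<in>K. \<forall>y\<in>K. x \<otimes> y \<in> K) \<and> S \<subseteq> K"
    using assms
  proof (induction S)
    case empty
    show ?case by (rule exI[of _ "{\<one>}"]) simp
  next
    case (insert a S)
    then obtain H where H: "finite H" "H \<subseteq> carrier M" "\<one> \<in> H"
      "\<forall>x\<in>H. \<forall>y\<in>H. x \<otimes> y \<in> H" "S \<subseteq> H" by auto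
    obtain K where "finite K" "K \<subseteq> carrier M" "\<one> \<in> K"
      "\<And>x y. x \<in> K \<Longrightarrow> y \<in> K \<Longrightarrow> x \<otimes> y \<in> K" "H \<subseteq> K" "a \<in> K"
      by (rule finite_closure_insert[of H a]) (use H insert.prems in auto)
    then show ?case using H(5) by (intro exI[of _ K]) auto
  qed
  then obtain K where K: "finite K" "K \<subseteq> carrier M" "\<one> \<in> K"
    "\<And>x y. x \<in> K \<Longrightarrow> y \<in> K \<Longrightarrow> x \<otimes> y \<in> K" "S \<subseteq> K" by blast
  have "x \<in> K" if "x \<in> lp_generated M S" for x
    using that
  proof induction
    case (inverse x)
    then have "inv x \<in> K" "x \<in> carrier M" using inv_mem[OF K(2,3,4)] K(2) by auto
    then show ?case by simp
  qed (use K in auto)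
  then show ?thesis using K(1) by (meson finite_subset subsetI)
qed

end


section \<open>The Fraisse limit\<close>

locale fraisse_G2pP =
  fixes p :: nat and D :: "'a lp_struct"
  assumes prime: "prime p" and fraisse: "fraisse_limit (K2pP p) D"
begin

lemma lp_structure_D: "lp_structure D"
  and countable_D: "countable (carrier D)"
  and homogeneous: "ultrahomogeneous D"
  and age_D: "age D = K2pP p"
  using fraisse by (simp_all add: fraisse_limit_def)

text \<open>A copy of the span on \<open>nat\<close> belongs to \<open>age D\<close>, hence to
  \<open>K2pP p\<close>; the laws return along the copying map.\<close>

lemma span_laws:
  assumes "finite S" "S \<subseteq> carrier D"
  shows "G2pP_laws p (lp_span D S)"
proof -
  let ?A = "lp_span D S"
  have sub: "lp_generated D S \<subseteq> carrier D"
    using lp_structure_D assms(2) by (rule lp_generated_subset)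
  then have "countable (carrier ?A)"
    using countable_D countable_subset by auto
  then obtain f and N :: "nat lp_struct" where N: "lp_structure N" "lp_iso f ?A N"
    using countable_copy[OF lp_structure_span] by blast
  have emb: "lp_embedding f ?A N" and onto: "carrier N = f ` carrier ?A"
    using N(2) by (auto simp: lp_iso_def)
  have "lp_embedding (the_inv_into (carrier ?A) f) N ?A"
    using lp_iso_inverse[OF N(2) lp_structure_span] by (simp add: lp_iso_def)
  moreover have "lp_embedding (\<lambda>x. x) ?A D"
    using lp_embedding_restrict[OF lp_embedding_id sub] .
  ultimately have "\<exists>h. lp_embedding h N D"
    using lp_embedding_comp by blast
  moreover have "finitely_generated N"
    unfolding finitely_generated_def
  proof (intro exI conjI)
    have "S \<subseteq> carrier ?A" by (auto intro: lp_generated.incl)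
    then show "finite (f ` S)" "f ` S \<subseteq> carrier N" "carrier N = lp_generated N (f ` S)"
      using assms(1) lp_embedding_generated[OF lp_structure_span emb, of S]
      by (auto simp: onto lp_generated_span)
  qed
  ultimately have "N \<in> K2pP p"
    using N(1) unfolding age_D[symmetric] age_def by blast
  then have "G2pP_laws p N"
    by (simp add: K2pP_def in_G2pP_iff_laws)
  then show ?thesis
    using laws_embedding[OF lp_structure_span emb] by blast
qed

text \<open>Each law involves at most three elements, so it can be read in the substructure they
  generate, whose operations are those of \<open>D\<close>.\<close>

lemma laws_D: "G2pP_laws p D"
proof -
  have L: "G2pP_laws p (lp_span D {x, y, z})" "{x, y, z} \<subseteq> lp_generated D {x, y, z}"
    if "x \<in> carrier D" "y \<in> carrier D" "z \<in> carrier D" for x y z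
    using that by (auto intro!: span_laws lp_generated.incl)
  have pow: "x [^]\<^bsub>lp_substructure D A\<^esub> n = x [^]\<^bsub>D\<^esub> n" for x A and n :: nat
    by (simp add: nat_pow_def)
  note L' = L[unfolded G2pP_laws_def lp_substructure_simps pow]
  have P: "x \<in> carrier D" if "x \<in> predP D" for x
    using that lp_structure_D by (auto simp: lp_structure_def)
  show ?thesis
    unfolding G2pP_laws_def
  proof (intro conjI ballI)
    show "lp_structure D" by (rule lp_structure_D)
    show "\<one>\<^bsub>D\<^esub> \<in> predP D"
      using L'[of "\<one>\<^bsub>D\<^esub>" "\<one>\<^bsub>D\<^esub>" "\<one>\<^bsub>D\<^esub>"] lp_structure_D by (auto simp: lp_structure_def)
    fix x assume "x \<in> carrier D"
    note L1 = L'[OF this this this]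
    show "\<one>\<^bsub>D\<^esub> \<otimes>\<^bsub>D\<^esub> x = x" "inv_op D x \<otimes>\<^bsub>D\<^esub> x = \<one>\<^bsub>D\<^esub>" "x [^]\<^bsub>D\<^esub> p = \<one>\<^bsub>D\<^esub>"
      using L1 by blast+
  next
    fix x y z assume "x \<in> carrier D" "y \<in> carrier D" "z \<in> carrier D"
    from L'[OF this] show "x \<otimes>\<^bsub>D\<^esub> y \<otimes>\<^bsub>D\<^esub> z = x \<otimes>\<^bsub>D\<^esub> (y \<otimes>\<^bsub>D\<^esub> z)" by simp
  next
    fix x y assume "x \<in> carrier D" "y \<in> carrier D"
    from L'[OF this this(2)]
    show "inv_op D x \<otimes>\<^bsub>D\<^esub> inv_op D y \<otimes>\<^bsub>D\<^esub> x \<otimes>\<^bsub>D\<^esub> y \<in> predP D" by simp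
  next
    fix x assume x: "x \<in> predP D"
    from L'[OF P[OF x] P[OF x] P[OF x]] x show "inv_op D x \<in> predP D" by simp
  next
    fix x y assume x: "x \<in> predP D" "y \<in> predP D"
    from L'[OF P[OF x(1)] P[OF x(2)] P[OF x(2)]] x show "x \<otimes>\<^bsub>D\<^esub> y \<in> predP D" by simp
  next
    fix x y assume x: "x \<in> predP D" "y \<in> carrier D"
    note L2 = L'[OF P[OF x(1)] x(2) x(2)]
    then have "\<forall>u\<in>predP D \<inter> lp_generated D {x, y, y}. \<forall>v\<in>lp_generated D {x, y, y}. u \<otimes>\<^bsub>D\<^esub> v = v \<otimes>\<^bsub>D\<^esub> u"
      by blast
    then show "x \<otimes>\<^bsub>D\<^esub> y = y \<otimes>\<^bsub>D\<^esub> x" using x(1) L2(2) by blast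
  qed
qed

section \<open>Universality of \<open>D\<close> for the countable structures of the class\<close>

lemma finite_embeds:
  fixes A :: "'b lp_struct"
  assumes "G2pP_laws p A" "finite (carrier A)"
  obtains h where "lp_embedding h A D"
proof -
  have A: "lp_structure A" using assms(1) by (simp add: G2pP_laws_def)
  obtain f and N :: "nat lp_struct" where N: "lp_structure N" "lp_iso f A N"
    using countable_copy[OF A countable_finite[OF assms(2)]] by blast
  have "lp_embedding (the_inv_into (carrier A) f) N A"
    using lp_iso_inverse[OF N(2) A] by (simp add: lp_iso_def)
  then have "G2pP_laws p N" using laws_embedding[OF N(1)] assms(1) by blast
  moreover have "finite (carrier N)" using N(2) assms(2) by (metis finite_imageI lp_iso_def)
  ultimately have "N \<in> age D" by (simp add: age_D K2pP_def in_G2pP_iff_laws)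
  then obtain g where "lp_embedding g N D" by (auto simp: age_def)
  moreover have "lp_embedding f A N" using N(2) by (simp add: lp_iso_def)
  ultimately show ?thesis using lp_embedding_comp that by blast
qed

text \<open>Homogeneity as an extension property: the larger span embeds in \<open>D\<close>
  somehow, by \<open>k\<close>, and an automorphism of \<open>D\<close> then corrects
  \<open>k\<close> so that it agrees with \<open>h\<close> on the smaller span.\<close>

lemma extend_embedding:
  fixes A :: "'b lp_struct"
  assumes A: "G2pP_laws p A" and S: "finite S" "S \<subseteq> T" and T: "finite T" "T \<subseteq> carrier A"
    and h: "lp_embedding h (lp_span A S) D"
  obtains h' where "lp_embedding h' (lp_span A T) D" "\<forall>x\<in>lp_generated A S. h' x = h x"
proof -
  interpret A: G2pP_prime p A by unfold_locales (rule A, rule prime)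
  let ?B = "lp_span A S" and ?C = "lp_span A T"
  have sub: "lp_generated A S \<subseteq> lp_generated A T" "lp_generated A T \<subseteq> carrier A"
    using lp_generated_mono[OF S(2)] lp_generated_subset[OF A.lp_structure_M T(2)] by auto
  have "G2pP_laws p ?C"
    using laws_embedding[OF lp_structure_span lp_embedding_restrict[OF lp_embedding_id sub(2)] A] .
  then obtain k where k: "lp_embedding k ?C D"
    using finite_embeds[of ?C] A.finite_generated[OF T] by auto
  have kB: "lp_embedding k ?B D"
    using lp_embedding_restrict[OF k, of "lp_generated A S"] sub(1)
    by (simp add: lp_substructure_def Int_absorb1 Int_assoc)
  have SB: "S \<subseteq> carrier ?B" by (auto intro: lp_generated.incl)
  have iso: "lp_iso f ?B (lp_span D (f ` S))" "f ` S \<subseteq> carrier D" if f: "lp_embedding f ?B D" for f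
  proof -
    have "lp_iso f (lp_span ?B S) (lp_span D (f ` S))"
      by (rule lp_iso_span[OF lp_structure_span f SB])
    then show "lp_iso f ?B (lp_span D (f ` S))"
      by (simp add: lp_generated_span) (simp add: lp_substructure_def)
    show "f ` S \<subseteq> carrier D" using f SB by (auto simp: lp_embedding_def)
  qed
  \<comment> \<open>Compares the two images of the span of \<open>S\<close> in \<open>D\<close>: it
    carries \<open>k x\<close> to \<open>h x\<close>.\<close>
  define j where "j = h \<circ> the_inv_into (carrier ?B) k"
  have "lp_iso j (lp_span D (k ` S)) (lp_span D (h ` S))"
    unfolding j_def using lp_iso_comp lp_iso_inverse[OF iso(1)[OF kB] lp_structure_span] iso(1)[OF h]
    by blast
  then obtain g where g: "lp_iso g D D" "\<forall>x\<in>lp_generated D (k ` S). g x = j x"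
    using homogeneous[unfolded ultrahomogeneous_def, rule_format, of "k ` S" "h ` S" j]
      iso(2)[OF kB] iso(2)[OF h] S(1) by auto
  show ?thesis
  proof
    show "lp_embedding (g \<circ> k) ?C D"
      using lp_embedding_comp[OF k, of g D] g(1) by (simp add: lp_iso_def)
    show "\<forall>x\<in>lp_generated A S. (g \<circ> k) x = h x"
    proof
      fix x assume x: "x \<in> lp_generated A S"
      have "k ` carrier ?B = lp_generated D (k ` S)"
        using iso(1)[OF kB] by (simp add: lp_iso_def)
      then have "g (k x) = j (k x)" using g(2) x by auto
      also have "\<dots> = h x"
        using the_inv_into_f_f[of k "carrier ?B" x] kB x by (simp add: j_def lp_embedding_def)
      finally show "(g \<circ> k) x = h x" by simp
    qed
  qed
qed

text \<open>The structure is the union of an increasing chain of finitely generated spans;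
  embeddings chosen compatibly along the chain glue to one embedding.\<close>

lemma countable_embeds:
  fixes A :: "'b lp_struct"
  assumes A: "G2pP_laws p A" and count: "countable (carrier A)"
  obtains h where "lp_embedding h A D"
proof -
  interpret A: G2pP p A by unfold_locales (rule A)
  \<comment> \<open>For a finite carrier \<open>from_nat_into\<close> falls back to some element of
    it beyond the range of the enumeration, so no case distinction is needed.\<close>
  define S where "S n = from_nat_into (carrier A) ` {..<n}" for n :: nat
  define G where "G n = lp_generated A (S n)" for n
  have S: "finite (S n)" "S n \<subseteq> S (Suc n)" "S n \<subseteq> carrier A" for n
    using from_nat_into[of "carrier A"] A.one_closed by (auto simp: S_def)
  have G: "G m \<subseteq> G n" if "m \<le> n" for m n
    unfolding G_def S_def using that by (intro lp_generated_mono) auto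
  have GA: "G n \<subseteq> carrier A" for n
    unfolding G_def using lp_generated_subset[OF A.lp_structure_M S(3)] .
  have "\<exists>h. lp_embedding h (lp_span A (S 0)) D"
  proof -
    have "lp_generated A (S 0) = {\<one>\<^bsub>A\<^esub>}"
    proof (intro equalityI subsetI)
      fix x assume "x \<in> lp_generated A (S 0)"
      then show "x \<in> {\<one>\<^bsub>A\<^esub>}" by induction (auto simp: S_def)
    qed (auto intro: lp_generated.one)
    moreover have "G2pP_laws p (lp_span A (S 0))"
      using laws_embedding[OF lp_structure_span lp_embedding_restrict[OF lp_embedding_id] A]
        lp_generated_subset[OF A.lp_structure_M S(3)] by blast
    ultimately show ?thesis using finite_embeds[of "lp_span A (S 0)"] by auto
  qed
  then obtain h where h: "\<And>n. lp_embedding (h n) (lp_span A (S n)) D"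
    and step: "\<And>n. \<forall>x\<in>G n. h (Suc n) x = h n x"
    using dependent_nat_choice[of "\<lambda>n h. lp_embedding h (lp_span A (S n)) D"
        "\<lambda>n h h'. \<forall>x\<in>G n. h' x = h x"]
      extend_embedding[OF A S(1) S(2) S(1) S(3)] unfolding G_def by metis
  have mono: "h n x = h m x" if "m \<le> n" "x \<in> G m" for m n x
    using that(1)
  proof (induction rule: dec_induct)
    case (step n)
    then show ?case using \<open>\<And>n. \<forall>x\<in>G n. h (Suc n) x = h n x\<close> G that(2) by (metis subsetD)
  qed simp
  \<comment> \<open>The successor is there because stage \<open>n\<close> holds only the elements
    enumerated strictly below \<open>n\<close>.\<close>
  define idx where "idx x = Suc (to_nat_on (carrier A) x)" for x
  define H where "H x = h (idx x) x" for x
  have idx: "x \<in> G (idx x)" if "x \<in> carrier A" for x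
  proof -
    have "from_nat_into (carrier A) (to_nat_on (carrier A) x) = x"
      using count that by simp
    then have "x \<in> S (idx x)" unfolding S_def idx_def by (metis imageI lessI lessThan_iff)
    then show ?thesis by (auto simp: G_def lp_generated.incl)
  qed
  have H: "x \<in> G n \<and> H x = h n x" if "x \<in> carrier A" "idx x \<le> n" for x n
    using idx[OF that(1)] G[OF that(2)] mono[OF that(2)] by (auto simp: H_def)
  \<comment> \<open>Each clause of \<open>lp_embedding\<close> involves finitely many elements, so
    it can be verified at a single stage containing them all.\<close>
  have common: "\<exists>n. \<forall>x\<in>F. x \<in> G n \<and> H x = h n x" if "finite F" "F \<subseteq> carrier A" for F
  proof -
    have "\<exists>n. \<forall>x\<in>F. idx x \<le> n"
      using finite_nat_set_iff_bounded_le[of "idx ` F"] that(1) by auto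
    then show ?thesis using H that(2) by blast
  qed
  have emb: "inj_on (h n) (G n)" "h n ` G n \<subseteq> carrier D" "h n \<one>\<^bsub>A\<^esub> = \<one>\<^bsub>D\<^esub>"
    "\<And>x y. x \<in> G n \<Longrightarrow> y \<in> G n \<Longrightarrow> h n (x \<otimes>\<^bsub>A\<^esub> y) = h n x \<otimes>\<^bsub>D\<^esub> h n y"
    "\<And>x. x \<in> G n \<Longrightarrow> h n (inv_op A x) = inv_op D (h n x)"
    "\<And>x. x \<in> G n \<Longrightarrow> h n x \<in> predP D \<longleftrightarrow> x \<in> predP A" for n
    using h[of n] unfolding lp_embedding_def G_def lp_substructure_simps by auto
  have "lp_embedding H A D"
    unfolding lp_embedding_def
  proof (intro conjI ballI inj_onI subsetI)
    fix y assume "y \<in> H ` carrier A"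
    then obtain x where x: "x \<in> carrier A" "y = H x" by blast
    then obtain n where "x \<in> G n" "H x = h n x" using common[of "{x}"] by auto
    then show "y \<in> carrier D" using emb(2) x by auto
  next
    obtain n where "H \<one>\<^bsub>A\<^esub> = h n \<one>\<^bsub>A\<^esub>" using common[of "{\<one>\<^bsub>A\<^esub>}"] by auto
    then show "H \<one>\<^bsub>A\<^esub> = \<one>\<^bsub>D\<^esub>" using emb(3) by simp
  next
    fix x y assume xy: "x \<in> carrier A" "y \<in> carrier A" "H x = H y"
    then obtain n where "x \<in> G n" "H x = h n x" "y \<in> G n" "H y = h n y"
      using common[of "{x, y}"] by auto
    then show "x = y" using emb(1)[of n] xy(3) by (auto dest: inj_onD)
  next
    fix x y assume xy: "x \<in> carrier A" "y \<in> carrier A"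
    then obtain n where "x \<in> G n" "H x = h n x" "y \<in> G n" "H y = h n y"
        "H (x \<otimes>\<^bsub>A\<^esub> y) = h n (x \<otimes>\<^bsub>A\<^esub> y)"
      using common[of "{x, y, x \<otimes>\<^bsub>A\<^esub> y}"] by auto
    then show "H (x \<otimes>\<^bsub>A\<^esub> y) = H x \<otimes>\<^bsub>D\<^esub> H y" using emb(4) by simp
  next
    fix x assume x: "x \<in> carrier A"
    then obtain n where "x \<in> G n" "H x = h n x" "H (inv_op A x) = h n (inv_op A x)"
      using common[of "{x, inv_op A x}"] by auto
    then show "H (inv_op A x) = inv_op D (H x)" "H x \<in> predP D \<longleftrightarrow> x \<in> predP A"
      using emb(5,6) by simp_all
  qed
  then show ?thesis by (rule that)
qed

end

section \<open>Homomorphisms into the predicate\<close>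

context G2pP_prime
begin

text \<open>Graphs of homomorphisms to \<open>predP M\<close>, defined on a subgroup containing \<open>predP M\<close>
  and trivial on \<open>predP M\<close>. The last conjunct makes \<open>\<Gamma>\<close> single-valued.\<close>

definition partial_hom :: "('a \<times> 'a) set \<Rightarrow> bool" where
  "partial_hom \<Gamma> \<longleftrightarrow>
     \<Gamma> \<subseteq> carrier M \<times> predP M \<and> predP M \<times> {\<one>} \<subseteq> \<Gamma> \<and>
     (\<forall>(x, y)\<in>\<Gamma>. \<forall>(u, v)\<in>\<Gamma>. (x \<otimes> u, y \<otimes> v) \<in> \<Gamma>) \<and>
     (\<forall>y. (\<one>, y) \<in> \<Gamma> \<longrightarrow> y = \<one>)"

lemma partial_homD:
  assumes "partial_hom \<Gamma>"
  shows "(x, y) \<in> \<Gamma> \<Longrightarrow> x \<in> carrier M" "(x, y) \<in> \<Gamma> \<Longrightarrow> y \<in> predP M"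
    "c \<in> predP M \<Longrightarrow> (c, \<one>) \<in> \<Gamma>"
    "(x, y) \<in> \<Gamma> \<Longrightarrow> (u, v) \<in> \<Gamma> \<Longrightarrow> (x \<otimes> u, y \<otimes> v) \<in> \<Gamma>"
    "(\<one>, y) \<in> \<Gamma> \<Longrightarrow> y = \<one>"
  using assms unfolding partial_hom_def by blast+

lemma partial_hom_pow:
  assumes "partial_hom \<Gamma>" "(x, y) \<in> \<Gamma>"
  shows "(x [^] (n::nat), y [^] n) \<in> \<Gamma>"
  by (induction n) (auto intro: partial_homD[OF assms(1)] assms(2))

lemma partial_hom_inv:
  assumes "partial_hom \<Gamma>" "(x, y) \<in> \<Gamma>"
  shows "(inv x, inv y) \<in> \<Gamma>"
  using partial_hom_pow[OF assms, of "p - 1"] partial_homD(1,2)[OF assms] by (simp add: inv_eq_pow)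

lemma partial_hom_unique:
  assumes "partial_hom \<Gamma>" "(x, y) \<in> \<Gamma>" "(x, z) \<in> \<Gamma>"
  shows "y = z"
proof -
  note D = partial_homD[OF assms(1)]
  have "(inv x \<otimes> x, inv y \<otimes> z) \<in> \<Gamma>"
    using D(4) partial_hom_inv assms by blast
  moreover have c: "x \<in> carrier M" "y \<in> carrier M" "z \<in> carrier M"
    using D(1,2) assms(2,3) P_carrier by blast+
  ultimately have "inv y \<otimes> z = \<one>" using D(5) by simp
  then show ?thesis using c by (metis inv_equality inv_inv inv_closed)
qed

text \<open>The new element \<open>m\<close> is sent to \<open>\<one>\<close>. This is consistent
  because \<open>p\<close> is prime: if a power of \<open>m\<close> with exponent prime to
  \<open>p\<close> were in the domain, so would \<open>m\<close> itself.\<close>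

lemma partial_hom_extend:
  assumes \<Gamma>: "partial_hom \<Gamma>" and m: "m \<in> carrier M" "m \<notin> Domain \<Gamma>"
  shows "\<exists>\<Delta>. partial_hom \<Delta> \<and> \<Gamma> \<subset> \<Delta>"
proof (intro exI conjI)
  note D = partial_homD[OF \<Gamma>]
  define \<Delta> where "\<Delta> = {(h \<otimes> m [^] i, y) | h i y. (h, y) \<in> \<Gamma> \<and> i \<in> (UNIV :: nat set)}"
  have "\<Gamma> \<subseteq> \<Delta>"
  proof clarify
    fix h y assume "(h, y) \<in> \<Gamma>"
    moreover from this have "(h, y) = (h \<otimes> m [^] (0::nat), y)" using D(1) by simp
    ultimately show "(h, y) \<in> \<Delta>" unfolding \<Delta>_def by blast
  qed
  moreover have "(\<one> \<otimes> m [^] (1::nat), \<one>) \<in> \<Delta>"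
    unfolding \<Delta>_def using D(3) P_one by blast
  ultimately show "\<Gamma> \<subset> \<Delta>" using m by auto
  show "partial_hom \<Delta>"
    unfolding partial_hom_def
  proof (intro conjI)
    show "\<Delta> \<subseteq> carrier M \<times> predP M" using D(1,2) m(1) by (auto simp: \<Delta>_def)
    show "predP M \<times> {\<one>} \<subseteq> \<Delta>" using \<open>\<Gamma> \<subseteq> \<Delta>\<close> D(3) by blast
    have "(x \<otimes> u, y \<otimes> v) \<in> \<Delta>" if xy: "(x, y) \<in> \<Delta>" and uv: "(u, v) \<in> \<Delta>" for x y u v
    proof -
      from xy obtain h i where x: "x = h \<otimes> m [^] (i::nat)" "(h, y) \<in> \<Gamma>" unfolding \<Delta>_def by blast
      from uv obtain k j where u: "u = k \<otimes> m [^] (j::nat)" "(k, v) \<in> \<Gamma>" unfolding \<Delta>_def by blast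
      have c: "h \<in> carrier M" "k \<in> carrier M" "y \<in> carrier M" "v \<in> carrier M"
        using D(1,2) x(2) u(2) P_carrier by blast+
      \<comment> \<open>\<open>m [^] i\<close> and \<open>k\<close> need not commute, but their
        commutator \<open>c\<close> lies in \<open>predP M\<close>, where the homomorphism is
        trivial, so the value is unaffected.\<close>
      obtain c where cP: "c \<in> predP M" "m [^] i \<otimes> k = k \<otimes> m [^] i \<otimes> c"
        using commute_P[OF nat_pow_closed[OF m(1)] c(2)] .
      have "x \<otimes> u = h \<otimes> (m [^] i \<otimes> k) \<otimes> m [^] j"
        using c m(1) by (simp add: x u m_assoc)
      also have "\<dots> = (h \<otimes> k \<otimes> c) \<otimes> (m [^] i \<otimes> m [^] j)"
        using c m(1) cP(1) by (simp add: cP(2) m_assoc P_left_commute[of c])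
      finally have "x \<otimes> u = (h \<otimes> k \<otimes> c) \<otimes> m [^] (i + j)"
        using m(1) by (simp add: nat_pow_mult)
      moreover have "(h \<otimes> k \<otimes> c, y \<otimes> v \<otimes> \<one>) \<in> \<Gamma>"
        by (intro D(3,4) x u cP)
      ultimately show ?thesis using c unfolding \<Delta>_def by auto
    qed
    then show "\<forall>(x, y)\<in>\<Delta>. \<forall>(u, v)\<in>\<Delta>. (x \<otimes> u, y \<otimes> v) \<in> \<Delta>" by blast
    show "\<forall>y. (\<one>, y) \<in> \<Delta> \<longrightarrow> y = \<one>"
    proof (intro allI impI)
      fix y assume "(\<one>, y) \<in> \<Delta>"
      then obtain h i where h: "\<one> = h \<otimes> m [^] (i::nat)" "(h, y) \<in> \<Gamma>" unfolding \<Delta>_def by blast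
      have hc: "h \<in> carrier M" using D(1) h(2) .
      show "y = \<one>"
      proof (cases "p dvd i")
        case True
        then have "m [^] i = \<one>" using m(1) by (rule pow_multiple_p[rotated])
        then have "h = \<one>" using h(1) hc by (metis r_one)
        then show ?thesis using h(2) D(5) by simp
      next
        case False
        \<comment> \<open>An inverse \<open>k\<close> of \<open>i\<close> modulo \<open>p\<close>
          recovers \<open>m\<close> from \<open>m [^] i\<close>, contradicting that \<open>m\<close>
          is outside the domain.\<close>
        then have "coprime i p" using prime prime_imp_coprime coprime_commute by blast
        then obtain k where "[i * k = Suc 0] (mod p)" using cong_solve_coprime_nat by blast
        then have k: "i * k mod p = 1" using prime_gt_1_nat[OF prime] by (simp add: cong_def)
        have "m [^] i = inv h"
          using h(1) hc m(1) by (metis inv_comm inv_equality nat_pow_closed)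
        then have "m [^] i \<in> Domain \<Gamma>" using partial_hom_inv[OF \<Gamma> h(2)] by auto
        then have "(m [^] i) [^] k \<in> Domain \<Gamma>" using partial_hom_pow[OF \<Gamma>] by blast
        moreover have "(m [^] i) [^] k = m"
          using pow_mod_p[OF m(1), of "i * k"] k m(1) by (simp add: nat_pow_pow)
        ultimately show ?thesis using m(2) by simp
      qed
    qed
  qed
qed

text \<open>A basis-free form of extending a linear map on \<open>M/P(M)\<close>: Zorn gives a
  maximal graph, and \<open>partial_hom_extend\<close> shows that its domain is everything.\<close>

lemma partial_hom_total:
  assumes "partial_hom \<Gamma>"
  obtains \<phi> where "\<And>x. x \<in> carrier M \<Longrightarrow> \<phi> x \<in> predP M"
    "\<And>x y. x \<in> carrier M \<Longrightarrow> y \<in> carrier M \<Longrightarrow> \<phi> (x \<otimes> y) = \<phi> x \<otimes> \<phi> y"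
    "\<And>x. x \<in> predP M \<Longrightarrow> \<phi> x = \<one>"
    "\<And>x y. (x, y) \<in> \<Gamma> \<Longrightarrow> \<phi> x = y"
proof -
  let ?\<A> = "{\<Delta>. partial_hom \<Delta> \<and> \<Gamma> \<subseteq> \<Delta>}"
  have "\<exists>\<Delta>\<in>?\<A>. \<forall>\<Delta>'\<in>?\<A>. \<Delta> \<subseteq> \<Delta>' \<longrightarrow> \<Delta>' = \<Delta>"
  proof (rule subset_Zorn_nonempty)
    show "?\<A> \<noteq> {}" using assms by blast
    fix \<C> assume ne: "\<C> \<noteq> {}" and chain: "subset.chain ?\<A> \<C>"
    then have sub: "\<And>\<Delta>. \<Delta> \<in> \<C> \<Longrightarrow> partial_hom \<Delta>" "\<And>\<Delta>. \<Delta> \<in> \<C> \<Longrightarrow> \<Gamma> \<subseteq> \<Delta>"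
      by (auto simp: subset_chain_def)
    obtain \<Delta>0 where \<Delta>0: "\<Delta>0 \<in> \<C>" using ne by blast
    have "(x \<otimes> u, y \<otimes> v) \<in> \<Union>\<C>" if xy: "(x, y) \<in> \<Union>\<C>" and uv: "(u, v) \<in> \<Union>\<C>" for x y u v
    proof -
      from xy uv obtain A B where AB: "A \<in> \<C>" "B \<in> \<C>" "(x, y) \<in> A" "(u, v) \<in> B" by blast
      have "A \<subseteq> B \<or> B \<subseteq> A" using chain AB by (auto simp: subset_chain_def)
      then show ?thesis using AB partial_homD(4)[OF sub(1)] by blast
    qed
    moreover have "\<Union>\<C> \<subseteq> carrier M \<times> predP M"
      using partial_homD(1,2)[OF sub(1)] by fast
    moreover have "predP M \<times> {\<one>} \<subseteq> \<Union>\<C>"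
      using partial_homD(3)[OF sub(1)[OF \<Delta>0]] \<Delta>0 by blast
    moreover have "\<forall>y. (\<one>, y) \<in> \<Union>\<C> \<longrightarrow> y = \<one>"
      using partial_homD(5)[OF sub(1)] by blast
    ultimately have "partial_hom (\<Union>\<C>)" unfolding partial_hom_def by blast
    then show "\<Union>\<C> \<in> ?\<A>" using sub(2) \<Delta>0 by blast
  qed
  then obtain \<Delta> where \<Delta>: "partial_hom \<Delta>" "\<Gamma> \<subseteq> \<Delta>"
    and max: "\<And>\<Delta>'. partial_hom \<Delta>' \<Longrightarrow> \<Delta> \<subseteq> \<Delta>' \<Longrightarrow> \<Delta>' = \<Delta>" by auto
  define l where "l x = (THE y. (x, y) \<in> \<Delta>)" for x
  note D = partial_homD[OF \<Delta>(1)]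
  have l: "l x = y" if "(x, y) \<in> \<Delta>" for x y
    unfolding l_def using that partial_hom_unique[OF \<Delta>(1)] by blast
  have dom: "(x, l x) \<in> \<Delta>" if "x \<in> carrier M" for x
  proof -
    have "x \<in> Domain \<Delta>" using partial_hom_extend[OF \<Delta>(1) that] max by blast
    then show ?thesis using l by blast
  qed
  show ?thesis
  proof
    show "\<And>x. x \<in> carrier M \<Longrightarrow> l x \<in> predP M" using dom D(2) by blast
    show "\<And>x y. x \<in> carrier M \<Longrightarrow> y \<in> carrier M \<Longrightarrow> l (x \<otimes> y) = l x \<otimes> l y"
      by (intro l D(4) dom)
    show "\<And>x. x \<in> predP M \<Longrightarrow> l x = \<one>" using D(3) l by blast
    show "\<And>x y. (x, y) \<in> \<Gamma> \<Longrightarrow> l x = y" using \<Delta>(2) l by blast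
  qed
qed

end


text \<open>The binomial coefficient is \<open>p * ((p - 1) / 2)\<close>. It appears as an exponent
  in \<open>E_pow\<close> and as a coefficient in \<open>array_group_pow\<close>.\<close>

lemma prime_dvd_choose_two:
  fixes p :: nat
  assumes "prime p" "p > 2"
  shows "p dvd p choose 2"
proof -
  have "even (p - 1)" using prime_odd_nat[OF assms] by simp
  then obtain k where "p - 1 = 2 * k" by (rule dvdE)
  then show ?thesis by (simp add: choose_two)
qed


section \<open>The cyclic extension defined by a homomorphism\<close>

text \<open>The semidirect product of \<open>M\<close> with the cyclic group of order \<open>p\<close> whose generator acts by
  \<open>m \<mapsto> m \<otimes> \<phi> m\<close>.\<close>

definition cyclic_extension :: "nat \<Rightarrow> 'a lp_struct \<Rightarrow> ('a \<Rightarrow> 'a) \<Rightarrow> ('a \<times> nat) lp_struct" where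
  "cyclic_extension p M \<phi> =
     \<lparr>carrier = carrier M \<times> {..<p},
      monoid.mult = (\<lambda>(m, i) (n, j). (m \<otimes>\<^bsub>M\<^esub> n \<otimes>\<^bsub>M\<^esub> \<phi> n [^]\<^bsub>M\<^esub> i, (i + j) mod p)),
      one = (\<one>\<^bsub>M\<^esub>, 0),
      inv_op = (\<lambda>(m, i). (inv\<^bsub>M\<^esub> m \<otimes>\<^bsub>M\<^esub> \<phi> m [^]\<^bsub>M\<^esub> i, (p - i) mod p)),
      predP = predP M \<times> {0}\<rparr>"

text \<open>Multiplicativity and triviality on \<open>predP M\<close> make
  \<open>m \<mapsto> m \<otimes> \<phi> m\<close> an automorphism whose \<open>i\<close>-th iterate
  is multiplication by \<open>\<phi> m [^] i\<close>; values in \<open>predP M\<close> keep the new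
  commutators inside the predicate.\<close>

locale cyclic_ext = G2pP_prime p M for p and M :: "'a lp_struct" (structure) +
  fixes \<phi> :: "'a \<Rightarrow> 'a"
  assumes odd: "p > 2"
    and \<phi>_P [simp]: "x \<in> carrier M \<Longrightarrow> \<phi> x \<in> predP M"
    and \<phi>_mult: "x \<in> carrier M \<Longrightarrow> y \<in> carrier M \<Longrightarrow> \<phi> (x \<otimes> y) = \<phi> x \<otimes> \<phi> y"
    and \<phi>_on_P [simp]: "x \<in> predP M \<Longrightarrow> \<phi> x = \<one>"
begin

abbreviation E where "E \<equiv> cyclic_extension p M \<phi>"

lemma P_pow_mult: "x \<in> predP M \<Longrightarrow> y \<in> predP M \<Longrightarrow> (x \<otimes> y) [^] (n::nat) = x [^] n \<otimes> y [^] n"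
  by (rule pow_mult_distrib) (auto simp: P_central)

lemma \<phi>_pow: "x \<in> carrier M \<Longrightarrow> \<phi> (x [^] (n::nat)) = \<phi> x [^] n"
  by (induction n) (auto simp: \<phi>_mult)

lemma E_simps:
  "carrier E = carrier M \<times> {..<p}" "\<one>\<^bsub>E\<^esub> = (\<one>, 0)" "predP E = predP M \<times> {0}"
  "(m, i) \<otimes>\<^bsub>E\<^esub> (n, j) = (m \<otimes> n \<otimes> \<phi> n [^] i, (i + j) mod p)"
  "inv_op E (m, i) = (inv m \<otimes> \<phi> m [^] i, (p - i) mod p)"
  by (simp_all add: cyclic_extension_def)

text \<open>Collecting the cyclic parts lets the factors of \<open>m\<close> pick up
  \<open>\<phi> m\<close> to the exponents \<open>0, i, ..., (n - 1) * i\<close>, whose sum is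
  \<open>i * (n choose 2)\<close>.\<close>

lemma E_pow:
  assumes "m \<in> carrier M"
  shows "(m, i) [^]\<^bsub>E\<^esub> (n::nat) = (m [^] n \<otimes> \<phi> m [^] (i * (n choose 2)), n * i mod p)"
proof (induction n)
  case 0
  have "(m, i) [^]\<^bsub>E\<^esub> (0::nat) = \<one>\<^bsub>E\<^esub>" by (simp add: nat_pow_def)
  then show ?case by (simp add: E_simps numeral_2_eq_2)
next
  case (Suc n)
  have "(m, i) [^]\<^bsub>E\<^esub> Suc n
      = (m [^] n \<otimes> \<phi> m [^] (i * (n choose 2)), n * i mod p) \<otimes>\<^bsub>E\<^esub> (m, i)"
    using Suc by (simp add: nat_pow_def)
  also have "\<dots> = (m [^] n \<otimes> \<phi> m [^] (i * (n choose 2)) \<otimes> m \<otimes> \<phi> m [^] (n * i), Suc n * i mod p)"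
    using assms by (simp add: E_simps pow_mod_p) (metis add.commute mod_add_left_eq)
  also have "m [^] n \<otimes> \<phi> m [^] (i * (n choose 2)) \<otimes> m \<otimes> \<phi> m [^] (n * i)
      = m [^] n \<otimes> m \<otimes> (\<phi> m [^] (i * (n choose 2)) \<otimes> \<phi> m [^] (n * i))"
    using assms P_central[of "\<phi> m [^] (i * (n choose 2))" m]
      P_left_commute[of "\<phi> m [^] (i * (n choose 2))" m] by (simp add: m_assoc)
  also have "\<dots> = m [^] Suc n \<otimes> \<phi> m [^] (i * (Suc n choose 2))"
    using assms by (simp add: nat_pow_mult numeral_2_eq_2 algebra_simps)
  finally show ?case .
qed

lemma E_laws: "G2pP_laws p E"
  unfolding G2pP_laws_def
proof (intro conjI ballI)
  have p: "p > 0" using odd by simp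
  show "lp_structure E"
    using p by (auto simp: lp_structure_def E_simps)
  show "\<one>\<^bsub>E\<^esub> \<in> predP E" by (simp add: E_simps)
  fix x assume "x \<in> carrier E"
  then obtain m i where x: "x = (m, i)" "m \<in> carrier M" "i < p" by (auto simp: E_simps)
  show "\<one>\<^bsub>E\<^esub> \<otimes>\<^bsub>E\<^esub> x = x" using x by (simp add: E_simps)
  show "inv_op E x \<otimes>\<^bsub>E\<^esub> x = \<one>\<^bsub>E\<^esub>"
  proof -
    have "\<phi> m [^] i \<otimes> \<phi> m [^] ((p - i) mod p) = \<one>"
      using x by (simp add: pow_mod_p nat_pow_mult)
    moreover have "inv m \<otimes> \<phi> m [^] i \<otimes> m = \<phi> m [^] i"
      using x P_central[of "\<phi> m [^] i" m] by (simp add: m_assoc) (simp flip: m_assoc)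
    ultimately show ?thesis using x by (simp add: E_simps mod_add_left_eq)
  qed
  show "x [^]\<^bsub>E\<^esub> p = \<one>\<^bsub>E\<^esub>"
  proof -
    have "p dvd p choose 2" using prime odd by (rule prime_dvd_choose_two)
    then show ?thesis using x by (simp add: E_simps E_pow pow_multiple_p)
  qed
next
  fix x y z assume "x \<in> carrier E" "y \<in> carrier E" "z \<in> carrier E"
  then obtain m i n j r k where [simp]: "x = (m, i)" "y = (n, j)" "z = (r, k)"
    and [simp]: "m \<in> carrier M" "n \<in> carrier M" "r \<in> carrier M" by (auto simp: E_simps)
  have "m \<otimes> n \<otimes> \<phi> n [^] i \<otimes> r \<otimes> \<phi> r [^] (i + j) = m \<otimes> n \<otimes> (\<phi> n [^] i \<otimes> r) \<otimes> (\<phi> r [^] i \<otimes> \<phi> r [^] j)"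
    by (simp add: m_assoc nat_pow_mult)
  also have "\<dots> = m \<otimes> (n \<otimes> r \<otimes> \<phi> r [^] j) \<otimes> (\<phi> n [^] i \<otimes> \<phi> r [^] i)"
    using P_central[of "\<phi> n [^] i" r] P_central[of "\<phi> r [^] j" "\<phi> n [^] i \<otimes> \<phi> r [^] i"]
    by (simp add: m_assoc P_central[of "\<phi> r [^] i" "\<phi> r [^] j"])
  finally show "x \<otimes>\<^bsub>E\<^esub> y \<otimes>\<^bsub>E\<^esub> z = x \<otimes>\<^bsub>E\<^esub> (y \<otimes>\<^bsub>E\<^esub> z)"
    by (simp add: E_simps \<phi>_mult \<phi>_pow pow_mod_p P_pow_mult mod_add_left_eq mod_add_right_eq add.assoc)
next
  fix x y assume "x \<in> carrier E" "y \<in> carrier E"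
  then obtain m i n j where [simp]: "x = (m, i)" "y = (n, j)"
    and [simp]: "m \<in> carrier M" "n \<in> carrier M" and ij: "i < p" "j < p" by (auto simp: E_simps)
  have "inv_op E x \<otimes>\<^bsub>E\<^esub> inv_op E y \<otimes>\<^bsub>E\<^esub> x \<otimes>\<^bsub>E\<^esub> y \<in> carrier M \<times> {0}"
  proof -
    have "((((p - i) mod p + (p - j) mod p) mod p + i) mod p + j) mod p = ((p - i) + (p - j) + i + j) mod p"
      by (simp add: mod_simps)
    also have "\<dots> = 0" using ij by simp
    finally show ?thesis by (simp add: E_simps)
  qed
  moreover have "\<exists>q\<in>predP M. fst (inv_op E x \<otimes>\<^bsub>E\<^esub> inv_op E y \<otimes>\<^bsub>E\<^esub> x \<otimes>\<^bsub>E\<^esub> y) = inv m \<otimes> inv n \<otimes> m \<otimes> n \<otimes> q"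
  proof -
    \<comment> \<open>Equality up to a factor in \<open>predP M\<close> is respected by products.
      Modulo that relation the twist by \<open>\<phi>\<close> disappears, so the commutator in
      \<open>E\<close> reduces to the one in \<open>M\<close>.\<close>
    define R where "R u a \<longleftrightarrow> (\<exists>c\<in>predP M. fst u = a \<otimes> c)" for u :: "'a \<times> nat" and a
    have mult: "R (u \<otimes>\<^bsub>E\<^esub> v) (a \<otimes> b)"
      if uv: "R u a" "R v b" and ab: "a \<in> carrier M" "b \<in> carrier M" for u v a b
    proof -
      from uv obtain c d where cd: "c \<in> predP M" "fst u = a \<otimes> c" "d \<in> predP M" "fst v = b \<otimes> d"
        by (auto simp: R_def)
      have "fst (u \<otimes>\<^bsub>E\<^esub> v) = a \<otimes> c \<otimes> (b \<otimes> d) \<otimes> \<phi> (b \<otimes> d) [^] snd u"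
        using cd by (cases u, cases v) (simp add: E_simps)
      also have "\<dots> = a \<otimes> b \<otimes> (c \<otimes> (d \<otimes> \<phi> (b \<otimes> d) [^] snd u))"
        using cd ab by (simp add: m_assoc P_left_commute[of c])
      finally show ?thesis using cd ab unfolding R_def by auto
    qed
    have "R (inv_op E x) (inv m)" "R (inv_op E y) (inv n)" by (auto simp: R_def E_simps)
    moreover have "R x m" "R y n" by (auto simp: R_def intro!: bexI[of _ \<one>])
    ultimately show ?thesis unfolding R_def[symmetric] by (intro mult) auto
  qed
  ultimately show "inv_op E x \<otimes>\<^bsub>E\<^esub> inv_op E y \<otimes>\<^bsub>E\<^esub> x \<otimes>\<^bsub>E\<^esub> y \<in> predP E"
    using commutator_P[of m n] by (auto simp: E_simps(3) mem_Times_iff)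
next
  fix x assume "x \<in> predP E"
  then obtain a where x: "x = (a, 0)" "a \<in> predP M" by (auto simp: E_simps)
  show "inv_op E x \<in> predP E" using x by (simp add: E_simps)
  fix y
  {
    assume "y \<in> predP E"
    then show "x \<otimes>\<^bsub>E\<^esub> y \<in> predP E" using x by (auto simp: E_simps)
  next
    assume "y \<in> carrier E"
    \<comment> \<open>Swapping \<open>(a, 0)\<close> with an element of cyclic part \<open>j\<close>
      costs \<open>\<phi> a [^] j\<close>, which is trivial because \<open>a\<close> lies in
      \<open>predP M\<close>.\<close>
    then show "x \<otimes>\<^bsub>E\<^esub> y = y \<otimes>\<^bsub>E\<^esub> x" using x P_central by (auto simp: E_simps)
  }
qed

lemma E_embedding: "lp_embedding (\<lambda>m. (m, 0)) M E"
  using odd by (auto simp: lp_embedding_def E_simps inj_on_def)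

lemma E_commutator:
  assumes m: "m \<in> carrier M"
  defines "x \<equiv> (\<one>, 1)" and "y \<equiv> (m, 0)"
  shows "inv_op E x \<otimes>\<^bsub>E\<^esub> inv_op E y \<otimes>\<^bsub>E\<^esub> x \<otimes>\<^bsub>E\<^esub> y = (\<phi> m, 0)"
proof -
  have "\<phi> (inv m) = inv (\<phi> m)"
    using m \<phi>_mult[of "inv m" m] by (intro inv_equality[symmetric]) auto
  \<comment> \<open>The inverse of \<open>(\<one>, 1)\<close> is \<open>(\<one>, p - 1)\<close>, so
    \<open>inv m\<close> is multiplied by this power.\<close>
  moreover have "(inv (\<phi> m)) [^] (p - 1) = \<phi> m"
    using m inv_eq_pow[of "inv (\<phi> m)"] by simp
  ultimately show ?thesis
    using m odd P_central[of "\<phi> m" m]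
    by (simp add: x_def y_def E_simps mod_add_left_eq pow_mod_p m_assoc) (simp flip: m_assoc)
qed

end

section \<open>The array\<close>

text \<open>The vector space of countable dimension over the field with \<open>p\<close> elements,
  residues being represented by integers. Finite support keeps it countable, as
  \<open>countable_embeds\<close> requires.\<close>

definition finsupp :: "nat \<Rightarrow> (nat \<times> nat \<Rightarrow> int) set" where
  "finsupp p = {u. finite {x. u x \<noteq> 0} \<and> (\<forall>x. 0 \<le> u x \<and> u x < int p)}"

text \<open>The central extension of \<open>V = finsupp p\<close> by \<open>V\<close> with cocycle \<open>(u, v) \<mapsto> u (0, 0) * v\<close>:
  the commutator of the basis vector at \<open>(0, 0)\<close> with the one at \<open>k \<noteq> (0, 0)\<close> is the central
  basis vector at \<open>k\<close>. The basis vectors at \<open>(\<alpha>, 0)\<close>, \<open>(0, 0)\<close> and \<open>(\<alpha>, i + 1)\<close> are the parameters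
  \<open>b\<^sub>\<alpha>\<close>, \<open>c\<close> and \<open>d\<^sub>\<alpha>\<^sub>i\<close>.\<close>

definition array_group :: "nat \<Rightarrow> ((nat \<times> nat \<Rightarrow> int) \<times> (nat \<times> nat \<Rightarrow> int)) lp_struct" where
  "array_group p =
     \<lparr>carrier = finsupp p \<times> finsupp p,
      monoid.mult = (\<lambda>(u, w) (u', w').
        (\<lambda>x. (u x + u' x) mod int p, \<lambda>x. (w x + w' x + u (0, 0) * u' x) mod int p)),
      one = (\<lambda>_. 0, \<lambda>_. 0),
      inv_op = (\<lambda>(u, w). (\<lambda>x. - u x mod int p, \<lambda>x. (u (0, 0) * u x - w x) mod int p)),
      predP = {\<lambda>_. 0} \<times> finsupp p\<rparr>"

lemma array_group_simps:
  "carrier (array_group p) = finsupp p \<times> finsupp p"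
  "\<one>\<^bsub>array_group p\<^esub> = (\<lambda>_. 0, \<lambda>_. 0)"
  "predP (array_group p) = {\<lambda>_. 0} \<times> finsupp p"
  "(u, w) \<otimes>\<^bsub>array_group p\<^esub> (u', w') =
     (\<lambda>x. (u x + u' x) mod int p, \<lambda>x. (w x + w' x + u (0, 0) * u' x) mod int p)"
  "inv_op (array_group p) (u, w) =
     (\<lambda>x. - u x mod int p, \<lambda>x. (u (0, 0) * u x - w x) mod int p)"
  by (simp_all add: array_group_def)

lemma finsupp_mod: "u \<in> finsupp p \<Longrightarrow> u x mod int p = u x"
  by (cases x) (simp add: finsupp_def)

lemma finsupp_modI:
  assumes "p > 0" "finite F" "\<And>x. x \<notin> F \<Longrightarrow> g x = 0"
  shows "(\<lambda>x. g x mod int p) \<in> finsupp p"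
proof -
  have "{x. g x mod int p \<noteq> 0} \<subseteq> F" using assms(3) by force
  then show ?thesis using assms(1,2) by (auto simp: finsupp_def intro: finite_subset)
qed

text \<open>With \<open>mod_add_mult_right\<close>, strips the inner reductions from the central
  coordinate, leaving identities of integer polynomials.\<close>

lemma mod_add_mult_left: "(a mod m + b + c mod m * d) mod m = (a + b + c * d) mod m" for m :: int
  by (intro mod_add_cong mod_mult_cong mod_mod_trivial refl)

lemma mod_add_mult_right: "(a + b mod m + c * (d mod m)) mod m = (a + b + c * d) mod m" for m :: int
  by (intro mod_add_cong mod_mult_cong mod_mod_trivial refl)

text \<open>The cocycle contributes \<open>u (0, 0) * u\<close> once for every pair of factors,
  hence \<open>n choose 2\<close> times.\<close>

lemma array_group_pow:
  "(u, w) [^]\<^bsub>array_group p\<^esub> (n::nat) =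
     (\<lambda>x. int n * u x mod int p, \<lambda>x. (int n * w x + int (n choose 2) * u (0, 0) * u x) mod int p)"
proof (induction n)
  case 0
  then show ?case by (simp add: nat_pow_def array_group_simps numeral_2_eq_2)
next
  case (Suc n)
  have "(u, w) [^]\<^bsub>array_group p\<^esub> Suc n = (u, w) [^]\<^bsub>array_group p\<^esub> n \<otimes>\<^bsub>array_group p\<^esub> (u, w)"
    by (simp add: nat_pow_def)
  also have "\<dots> = (\<lambda>x. (int n * u x mod int p + u x) mod int p,
      \<lambda>x. ((int n * w x + int (n choose 2) * u (0, 0) * u x) mod int p + w x +
        (int n * u (0, 0) mod int p) * u x) mod int p)"
    by (simp add: Suc array_group_simps)
  also have "\<dots> = (\<lambda>x. int (Suc n) * u x mod int p,
      \<lambda>x. (int (Suc n) * w x + int (Suc n choose 2) * u (0, 0) * u x) mod int p)"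
    by (simp only: mod_add_mult_left mod_add_left_eq) (simp add: numeral_2_eq_2 algebra_simps)
  finally show ?case .
qed

lemma array_group_laws:
  assumes "prime p" "p > 2"
  shows "G2pP_laws p (array_group p)"
proof -
  have p: "p > 0" using assms(2) by simp
  note fin = finsupp_modI[OF p]
  have zero: "(\<lambda>_. 0) \<in> finsupp p" using p by (simp add: finsupp_def)
  have cl1: "(\<lambda>x. (u x + v x) mod int p) \<in> finsupp p" if "u \<in> finsupp p" "v \<in> finsupp p" for u v
    by (rule fin[of "{x. u x \<noteq> 0} \<union> {x. v x \<noteq> 0}"]) (use that in \<open>auto simp: finsupp_def\<close>)
  have cl2: "(\<lambda>x. (u x + v x + c * w x) mod int p) \<in> finsupp p"
    if "u \<in> finsupp p" "v \<in> finsupp p" "w \<in> finsupp p" for u v w c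
    by (rule fin[of "{x. u x \<noteq> 0} \<union> {x. v x \<noteq> 0} \<union> {x. w x \<noteq> 0}"])
      (use that in \<open>auto simp: finsupp_def\<close>)
  have cl3: "(\<lambda>x. - u x mod int p) \<in> finsupp p" if "u \<in> finsupp p" for u
    by (rule fin[of "{x. u x \<noteq> 0}"]) (use that in \<open>auto simp: finsupp_def\<close>)
  have cl4: "(\<lambda>x. (c * u x - v x) mod int p) \<in> finsupp p"
    if "u \<in> finsupp p" "v \<in> finsupp p" for u v c
    by (rule fin[of "{x. u x \<noteq> 0} \<union> {x. v x \<noteq> 0}"]) (use that in \<open>auto simp: finsupp_def\<close>)
  have struct: "lp_structure (array_group p)"
    using zero cl1 cl2 cl3 cl4 by (auto simp: lp_structure_def array_group_simps)
  have "p dvd p choose 2" using assms by (rule prime_dvd_choose_two)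
  then have choose: "int p dvd int (p choose 2)" by simp
  have pow: "x [^]\<^bsub>array_group p\<^esub> p = \<one>\<^bsub>array_group p\<^esub>" for x
    using choose by (cases x) (simp add: array_group_pow array_group_simps mod_eq_0_iff_dvd)
  have fst_mult: "fst (x \<otimes>\<^bsub>array_group p\<^esub> y) = (\<lambda>k. (fst x k + fst y k) mod int p)"
    and fst_inv: "fst (inv_op (array_group p) x) = (\<lambda>k. - fst x k mod int p)" for x y
    by (cases x, cases y, simp add: array_group_simps)+
  \<comment> \<open>The first coordinate is additive modulo \<open>p\<close>, so it vanishes on
    commutators.\<close>
  have fst_comm: "fst (inv_op (array_group p) x \<otimes>\<^bsub>array_group p\<^esub> inv_op (array_group p) y
      \<otimes>\<^bsub>array_group p\<^esub> x \<otimes>\<^bsub>array_group p\<^esub> y) = (\<lambda>_. 0)" for x y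
    by (simp add: fst_mult fst_inv mod_simps)
  show ?thesis
    unfolding G2pP_laws_def
  proof (intro conjI ballI)
    show "lp_structure (array_group p)" by (rule struct)
    show "\<one>\<^bsub>array_group p\<^esub> \<in> predP (array_group p)" using zero by (simp add: array_group_simps)
  next
    fix x y z :: "(nat \<times> nat \<Rightarrow> int) \<times> (nat \<times> nat \<Rightarrow> int)"
    obtain u w u' w' u'' w'' where "x = (u, w)" "y = (u', w')" "z = (u'', w'')"
      by (metis surj_pair)
    then show "x \<otimes>\<^bsub>array_group p\<^esub> y \<otimes>\<^bsub>array_group p\<^esub> z = x \<otimes>\<^bsub>array_group p\<^esub> (y \<otimes>\<^bsub>array_group p\<^esub> z)"
      by (simp only: array_group_simps mod_add_mult_left mod_add_mult_right mod_add_left_eq mod_add_right_eq)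
        (simp add: algebra_simps)
  next
    fix x assume "x \<in> carrier (array_group p)"
    then obtain u w where x: "x = (u, w)" "u \<in> finsupp p" "w \<in> finsupp p"
      by (auto simp: array_group_simps)
    show "\<one>\<^bsub>array_group p\<^esub> \<otimes>\<^bsub>array_group p\<^esub> x = x"
      using x by (simp add: array_group_simps finsupp_mod)
    show "inv_op (array_group p) x \<otimes>\<^bsub>array_group p\<^esub> x = \<one>\<^bsub>array_group p\<^esub>"
      using x by (simp add: array_group_simps mod_add_mult_left mod_add_left_eq)
    show "x [^]\<^bsub>array_group p\<^esub> p = \<one>\<^bsub>array_group p\<^esub>" by (rule pow)
  next
    fix x y assume "x \<in> carrier (array_group p)" "y \<in> carrier (array_group p)"
    then have "inv_op (array_group p) x \<otimes>\<^bsub>array_group p\<^esub> inv_op (array_group p) y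
        \<otimes>\<^bsub>array_group p\<^esub> x \<otimes>\<^bsub>array_group p\<^esub> y \<in> carrier (array_group p)"
      using struct by (simp add: lp_structure_def)
    then show "inv_op (array_group p) x \<otimes>\<^bsub>array_group p\<^esub> inv_op (array_group p) y
        \<otimes>\<^bsub>array_group p\<^esub> x \<otimes>\<^bsub>array_group p\<^esub> y \<in> predP (array_group p)"
      using fst_comm by (auto simp: array_group_simps(1,3) mem_Times_iff)
  next
    fix x assume "x \<in> predP (array_group p)"
    then obtain w where x: "x = (\<lambda>_. 0, w)" "w \<in> finsupp p" by (auto simp: array_group_simps)
    show "inv_op (array_group p) x \<in> predP (array_group p)"
      using x cl3[of w] by (simp add: array_group_simps)
    fix y
    show "x \<otimes>\<^bsub>array_group p\<^esub> y \<in> predP (array_group p)" if "y \<in> predP (array_group p)"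
      using that x cl1 by (auto simp: array_group_simps)
    show "x \<otimes>\<^bsub>array_group p\<^esub> y = y \<otimes>\<^bsub>array_group p\<^esub> x" if "y \<in> carrier (array_group p)"
      using that x by (cases y) (simp add: array_group_simps add.commute)
  qed
qed

lemma countable_finsupp: "countable (finsupp p)"
proof -
  \<comment> \<open>A finitely supported function is recovered from its graph over the support, a
    finite subset of a countable type.\<close>
  let ?graph = "\<lambda>u :: nat \<times> nat \<Rightarrow> int. {z. snd z = u (fst z) \<and> u (fst z) \<noteq> 0}"
  have "finite (?graph u)" if "u \<in> finsupp p" for u
  proof -
    have "?graph u = (\<lambda>x. (x, u x)) ` {x. u x \<noteq> 0}" by force
    then show ?thesis using that by (simp add: finsupp_def)
  qed
  then have "?graph ` finsupp p \<subseteq> {G. finite G}" by blast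
  then have "countable (?graph ` finsupp p)"
    using countable_subset countable_Collect_finite by blast
  moreover have "inj ?graph"
  proof (rule injI, rule ext)
    fix u v x assume eq: "?graph u = ?graph v"
    have "(x, y) \<in> ?graph u \<longleftrightarrow> (x, y) \<in> ?graph v" for y by (simp only: eq)
    then have "y = u x \<and> u x \<noteq> 0 \<longleftrightarrow> y = v x \<and> v x \<noteq> 0" for y by simp
    from this[of "u x"] this[of "v x"] show "u x = v x" by auto
  qed
  ultimately show ?thesis
    using countable_image_inj_on inj_on_subset by blast
qed

lemma countable_array_group: "countable (carrier (array_group p))"
  by (simp add: array_group_simps countable_finsupp)

section \<open>Basis vectors and the homomorphism attached to a path\<close>

definition delta :: "nat \<times> nat \<Rightarrow> nat \<times> nat \<Rightarrow> int" where
  "delta k = (\<lambda>x. if x = k then 1 else 0)"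

lemma delta_finsupp: "p > 1 \<Longrightarrow> delta k \<in> finsupp p"
  by (simp add: finsupp_def delta_def)

text \<open>The linear map with \<open>b\<^sub>\<alpha> \<mapsto> [c,
  d\<^sub>\<alpha>\<^sub>f\<^sub>(\<^sub>\<alpha>\<^sub>)]\<close> that sends every basis vector at
  \<open>(\<alpha>, i + 1)\<close> to zero. Column 0 is reserved for the \<open>b\<close>
  parameters, hence the successor.\<close>

definition path_hom ::
  "(nat \<Rightarrow> nat) \<Rightarrow> (nat \<times> nat \<Rightarrow> int) \<times> (nat \<times> nat \<Rightarrow> int) \<Rightarrow> (nat \<times> nat \<Rightarrow> int) \<times> (nat \<times> nat \<Rightarrow> int)"
  where "path_hom f a = (\<lambda>_. 0, \<lambda>(\<alpha>, i). if i = Suc (f \<alpha>) then fst a (\<alpha>, 0) else 0)"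

lemma path_hom_P:
  assumes "a \<in> carrier (array_group p)"
  shows "path_hom f a \<in> predP (array_group p)"
proof -
  obtain u w where a: "a = (u, w)" "u \<in> finsupp p" using assms by (auto simp: array_group_simps)
  have "{k. snd (path_hom f a) k \<noteq> 0} \<subseteq> (\<lambda>(\<alpha>, i). (\<alpha>, Suc (f \<alpha>))) ` {x. u x \<noteq> 0}"
    by (force simp: a path_hom_def split: if_splits)
  then have "finite {k. snd (path_hom f a) k \<noteq> 0}"
    using a(2) by (auto simp: finsupp_def intro: finite_surj)
  moreover have "0 \<le> u (0, 0)" "u (0, 0) < int p" using a(2) by (simp_all add: finsupp_def)
  then have "p > 0" by linarith
  ultimately show ?thesis
    using a by (auto simp: path_hom_def array_group_simps finsupp_def)
qed

lemma path_hom_mult: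
  "path_hom f (a \<otimes>\<^bsub>array_group p\<^esub> b) = path_hom f a \<otimes>\<^bsub>array_group p\<^esub> path_hom f b"
  by (cases a, cases b) (auto simp: path_hom_def array_group_simps)

lemma path_hom_on_P: "a \<in> predP (array_group p) \<Longrightarrow> path_hom f a = \<one>\<^bsub>array_group p\<^esub>"
  by (auto simp: path_hom_def array_group_simps)

lemma path_hom_delta: "path_hom f (delta (\<alpha>, 0), w) = (\<lambda>_. 0, delta (\<alpha>, Suc (f \<alpha>)))"
  by (auto simp: path_hom_def delta_def)


section \<open>The tree property\<close>

definition lp_comm :: "'a lp_struct \<Rightarrow> 'a \<Rightarrow> 'a \<Rightarrow> 'a" where
  "lp_comm M x y = inv_op M x \<otimes>\<^bsub>M\<^esub> inv_op M y \<otimes>\<^bsub>M\<^esub> x \<otimes>\<^bsub>M\<^esub> y"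

lemma sat_comm_formula: "sat M v comm_formula \<longleftrightarrow> lp_comm M (v 0) (v 1) = lp_comm M (v 2) (v 3)"
  by (simp add: comm_formula_def Comm_def lp_comm_def)

lemma lp_comm_embedding:
  assumes "lp_structure M" "lp_embedding h M N" "x \<in> carrier M" "y \<in> carrier M"
  shows "h (lp_comm M x y) = lp_comm N (h x) (h y)"
  using assms by (simp add: lp_comm_def lp_embedding_def lp_structure_def)

text \<open>The commutator is the antisymmetrised cocycle,
  \<open>u (0, 0) * v - v (0, 0) * u\<close> in the central coordinate; for
  \<open>k \<noteq> (0, 0)\<close> the second term vanishes.\<close>

lemma array_group_comm:
  assumes "p > 1" "k \<noteq> (0, 0)"
  shows "lp_comm (array_group p) (delta (0, 0), \<lambda>_. 0) (delta k, \<lambda>_. 0) = (\<lambda>_. 0, delta k)"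
proof -
  have "(0, 0) \<noteq> k" using assms(2) by simp
  then show ?thesis
    using assms delta_finsupp[OF assms(1), of k]
    by (simp add: lp_comm_def array_group_simps mod_simps finsupp_mod)
      (auto simp: delta_def fun_eq_iff mod_simps)
qed

text \<open>An embedding reflects the predicate, so \<open>A/P(A)\<close> embeds in
  \<open>M/P(M)\<close>. A homomorphism on the former is a partial one on the latter and extends to
  all of \<open>M\<close>.\<close>

lemma (in G2pP_prime) extend_hom_along_embedding:
  fixes A :: "'b lp_struct"
  assumes A: "G2pP_laws p A" and e: "lp_embedding e A M"
    and \<psi>: "\<And>a. a \<in> carrier A \<Longrightarrow> \<psi> a \<in> predP A"
      "\<And>a b. a \<in> carrier A \<Longrightarrow> b \<in> carrier A \<Longrightarrow> \<psi> (a \<otimes>\<^bsub>A\<^esub> b) = \<psi> a \<otimes>\<^bsub>A\<^esub> \<psi> b"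
      "\<And>a. a \<in> predP A \<Longrightarrow> \<psi> a = \<one>\<^bsub>A\<^esub>"
  obtains \<phi> where "\<And>x. x \<in> carrier M \<Longrightarrow> \<phi> x \<in> predP M"
    "\<And>x y. x \<in> carrier M \<Longrightarrow> y \<in> carrier M \<Longrightarrow> \<phi> (x \<otimes> y) = \<phi> x \<otimes> \<phi> y"
    "\<And>x. x \<in> predP M \<Longrightarrow> \<phi> x = \<one>"
    "\<And>a. a \<in> carrier A \<Longrightarrow> \<phi> (e a) = e (\<psi> a)"
proof -
  interpret A: G2pP p A by unfold_locales (rule A)
  define \<Gamma> where "\<Gamma> = {(e a \<otimes> c, e (\<psi> a)) | a c. a \<in> carrier A \<and> c \<in> predP M}"
  have eC: "e a \<in> carrier M" if "a \<in> carrier A" for a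
    using e that by (auto simp: lp_embedding_def)
  have eP: "e a \<in> predP M \<longleftrightarrow> a \<in> predP A" if "a \<in> carrier A" for a
    using e that by (auto simp: lp_embedding_def)
  have em: "e (a \<otimes>\<^bsub>A\<^esub> b) = e a \<otimes> e b" if "a \<in> carrier A" "b \<in> carrier A" for a b
    using e that by (auto simp: lp_embedding_def)
  have e1: "e \<one>\<^bsub>A\<^esub> = \<one>" using e by (simp add: lp_embedding_def)
  have \<psi>C: "\<psi> a \<in> carrier A" if "a \<in> carrier A" for a using \<psi>(1)[OF that] by simp
  have \<Gamma>I: "(e a \<otimes> c, e (\<psi> a)) \<in> \<Gamma>" if "a \<in> carrier A" "c \<in> predP M" for a c
    using that unfolding \<Gamma>_def by blast
  have "partial_hom \<Gamma>"
    unfolding partial_hom_def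
  proof (intro conjI allI impI)
    show "\<Gamma> \<subseteq> carrier M \<times> predP M"
      using eC eP \<psi>(1) \<psi>C by (auto simp: \<Gamma>_def)
    have "(c, \<one>) \<in> \<Gamma>" if "c \<in> predP M" for c
      using \<Gamma>I[OF A.one_closed that] that e1 \<psi>(3)[OF A.P_one] by simp
    then show "predP M \<times> {\<one>} \<subseteq> \<Gamma>" by blast
    have "(x \<otimes> u, y \<otimes> v) \<in> \<Gamma>" if xy: "(x, y) \<in> \<Gamma>" and uv: "(u, v) \<in> \<Gamma>" for x y u v
    proof -
      from xy obtain a c where a: "a \<in> carrier A" "c \<in> predP M" "x = e a \<otimes> c" "y = e (\<psi> a)"
        by (auto simp: \<Gamma>_def)
      from uv obtain b d where b: "b \<in> carrier A" "d \<in> predP M" "u = e b \<otimes> d" "v = e (\<psi> b)"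
        by (auto simp: \<Gamma>_def)
      have "x \<otimes> u = e (a \<otimes>\<^bsub>A\<^esub> b) \<otimes> (c \<otimes> d)"
        using a b eC by (simp add: em m_assoc P_left_commute[of c])
      moreover have "y \<otimes> v = e (\<psi> (a \<otimes>\<^bsub>A\<^esub> b))"
        using a b \<psi>C by (simp add: em \<psi>(2))
      ultimately show ?thesis using \<Gamma>I a b by simp
    qed
    then show "\<forall>(x, y)\<in>\<Gamma>. \<forall>(u, v)\<in>\<Gamma>. (x \<otimes> u, y \<otimes> v) \<in> \<Gamma>" by blast
    fix y assume "(\<one>, y) \<in> \<Gamma>"
    then obtain a c where a: "a \<in> carrier A" "c \<in> predP M" "\<one> = e a \<otimes> c" "y = e (\<psi> a)"
      by (auto simp: \<Gamma>_def)
    \<comment> \<open>Here single-valuedness rests on \<open>e\<close> reflecting the predicate: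
      \<open>e a\<close> in \<open>predP M\<close> forces \<open>a\<close> into
      \<open>predP A\<close>, where \<open>\<psi>\<close> is trivial.\<close>
    then have "e a = inv c" using eC by (metis P_carrier inv_equality)
    then have "a \<in> predP A" using a eP by (metis P_inv)
    then show "y = \<one>" using a \<psi>(3) e1 by simp
  qed
  then obtain \<phi> where \<phi>: "\<And>x. x \<in> carrier M \<Longrightarrow> \<phi> x \<in> predP M"
    "\<And>x y. x \<in> carrier M \<Longrightarrow> y \<in> carrier M \<Longrightarrow> \<phi> (x \<otimes> y) = \<phi> x \<otimes> \<phi> y"
    "\<And>x. x \<in> predP M \<Longrightarrow> \<phi> x = \<one>" "\<And>x y. (x, y) \<in> \<Gamma> \<Longrightarrow> \<phi> x = y"
    by (rule partial_hom_total) blast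
  have "\<phi> (e a) = e (\<psi> a)" if "a \<in> carrier A" for a
    using \<phi>(4)[OF \<Gamma>I[OF that P_one]] eC[OF that] by simp
  with \<phi>(1-3) show ?thesis by (rule that)
qed

text \<open>Consistency is phrased through self-embeddings of \<open>D\<close>, on its own type; the
  passage to \<open>nat\<close> and to elementary embeddings is left to the final proof.\<close>

lemma (in fraisse_G2pP) exists_array:
  assumes odd: "p > 2"
  obtains a where "\<And>\<alpha> i. assignment D (a \<alpha> i)"
    "\<And>\<alpha> i j. a \<alpha> i 1 = a \<alpha> j 1"
    "\<And>\<alpha> i j. i \<noteq> j \<Longrightarrow> lp_comm D (a \<alpha> i 2) (a \<alpha> i 3) \<noteq> lp_comm D (a \<alpha> j 2) (a \<alpha> j 3)"
    "\<And>f :: nat \<Rightarrow> nat. \<exists>h b. lp_embedding h D D \<and> b \<in> carrier D \<and>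
       (\<forall>\<alpha>. sat D ((h \<circ> a \<alpha> (f \<alpha>))(0 := b)) comm_formula)"
proof -
  interpret D: G2pP_prime p D by unfold_locales (rule laws_D, rule prime)
  let ?A = "array_group p"
  have p: "p > 1" using odd by simp
  have A: "G2pP_laws p ?A" using prime odd by (rule array_group_laws)
  interpret A: G2pP_prime p ?A by unfold_locales (rule A, rule prime)
  obtain e where e: "lp_embedding e ?A D"
    using countable_embeds[OF A countable_array_group] .
  define g where "g k = (delta k, \<lambda>_ :: nat \<times> nat. 0 :: int)" for k
  have gA: "g k \<in> carrier ?A" for k
    using delta_finsupp[OF p] A.one_closed by (simp add: g_def array_group_simps)
  have zA: "(\<lambda>_. 0, delta k) \<in> carrier ?A" for k
    using delta_finsupp[OF p] A.one_closed by (simp add: array_group_simps)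
  have egD: "e (g k) \<in> carrier D" for k
    using lp_embedding_carrier[OF e gA] .
  have comm: "lp_comm D (e (g (0, 0))) (e (g (\<alpha>, Suc i))) = e (\<lambda>_. 0, delta (\<alpha>, Suc i))" for \<alpha> i
    using lp_comm_embedding[OF A.lp_structure_M e gA gA, of "(0, 0)" "(\<alpha>, Suc i)"]
      array_group_comm[OF p, of "(\<alpha>, Suc i)"] by (simp add: g_def)
  \<comment> \<open>For \<open>\<alpha> = 0\<close> the parameter \<open>b\<close> coincides with
    \<open>c\<close>. This is harmless: the argument uses only that the \<open>b\<close> parameters
    are independent and that the commutators within a row differ.\<close>
  define a where "a \<alpha> i = (\<lambda>n :: nat. if n = 1 then e (g (\<alpha>, 0)) else if n = 2 then e (g (0, 0))
      else if n = 3 then e (g (\<alpha>, Suc i)) else \<one>\<^bsub>D\<^esub>)" for \<alpha> i :: nat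
  show ?thesis
  proof
    show "assignment D (a \<alpha> i)" for \<alpha> i
      by (simp add: assignment_def a_def egD)
    show "a \<alpha> i 1 = a \<alpha> j 1" for \<alpha> i j by (simp add: a_def)
    show "lp_comm D (a \<alpha> i 2) (a \<alpha> i 3) \<noteq> lp_comm D (a \<alpha> j 2) (a \<alpha> j 3)" if "i \<noteq> j" for \<alpha> i j
    proof
      assume "lp_comm D (a \<alpha> i 2) (a \<alpha> i 3) = lp_comm D (a \<alpha> j 2) (a \<alpha> j 3)"
      then have "e (\<lambda>_. 0, delta (\<alpha>, Suc i)) = e (\<lambda>_. 0, delta (\<alpha>, Suc j))"
        by (simp add: a_def comm)
      then have "delta (\<alpha>, Suc i) = delta (\<alpha>, Suc j)"
        using e zA unfolding lp_embedding_def by (metis inj_onD prod.inject)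
      then have "delta (\<alpha>, Suc i) (\<alpha>, Suc i) = delta (\<alpha>, Suc j) (\<alpha>, Suc i)" by simp
      with \<open>i \<noteq> j\<close> show False by (simp add: delta_def)
    qed
    fix f :: "nat \<Rightarrow> nat"
    obtain \<phi> where \<phi>: "\<And>x. x \<in> carrier D \<Longrightarrow> \<phi> x \<in> predP D"
      "\<And>x y. x \<in> carrier D \<Longrightarrow> y \<in> carrier D \<Longrightarrow> \<phi> (x \<otimes>\<^bsub>D\<^esub> y) = \<phi> x \<otimes>\<^bsub>D\<^esub> \<phi> y"
      "\<And>x. x \<in> predP D \<Longrightarrow> \<phi> x = \<one>\<^bsub>D\<^esub>"
      "\<And>a. a \<in> carrier ?A \<Longrightarrow> \<phi> (e a) = e (path_hom f a)"
      by (rule D.extend_hom_along_embedding[OF A e, of "path_hom f"])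
        (use path_hom_P path_hom_mult path_hom_on_P in blast)+
    interpret E: cyclic_ext p D \<phi>
      by unfold_locales (use odd \<phi> in auto)
    have "countable (carrier E.E)"
      using countable_D by (simp add: E.E_simps)
    \<comment> \<open>The extension of \<open>D\<close> by \<open>x\<close> is again countable, so
      it fits back into \<open>D\<close>; the parameters are moved by the resulting self-embedding
      \<open>h\<close>, and the image of \<open>x\<close> becomes the realisation
      \<open>b\<close>.\<close>
    then obtain k where k: "lp_embedding k E.E D"
      using countable_embeds[OF E.E_laws] by blast
    have E: "lp_structure E.E" using E.E_laws by (simp add: G2pP_laws_def)
    define h where "h = k \<circ> (\<lambda>m. (m, 0))"
    define b where "b = k (\<one>\<^bsub>D\<^esub>, 1)"
    have h: "lp_embedding h D D"
      unfolding h_def using lp_embedding_comp[OF E.E_embedding k] .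
    have xE: "(\<one>\<^bsub>D\<^esub>, 1) \<in> carrier E.E" using p by (simp add: E.E_simps)
    have b: "b \<in> carrier D" using k xE by (auto simp: b_def lp_embedding_def)
    have "sat D ((h \<circ> a \<alpha> (f \<alpha>))(0 := b)) comm_formula" for \<alpha>
    proof -
      have "lp_comm D b (h (e (g (\<alpha>, 0)))) = k (lp_comm E.E (\<one>\<^bsub>D\<^esub>, 1) (e (g (\<alpha>, 0)), 0))"
        using lp_comm_embedding[OF E k xE, of "(e (g (\<alpha>, 0)), 0)"] egD p
        by (simp add: b_def h_def E.E_simps(1))
      also have "\<dots> = h (\<phi> (e (g (\<alpha>, 0))))"
        using E.E_commutator[OF egD] by (simp add: lp_comm_def h_def)
      also have "\<phi> (e (g (\<alpha>, 0))) = lp_comm D (e (g (0, 0))) (e (g (\<alpha>, Suc (f \<alpha>))))"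
        using \<phi>(4)[OF gA, of "(\<alpha>, 0)"] path_hom_delta[of f \<alpha> "\<lambda>_. 0", folded g_def] comm by simp
      also have "h \<dots> = lp_comm D (h (e (g (0, 0)))) (h (e (g (\<alpha>, Suc (f \<alpha>)))))"
        using lp_comm_embedding[OF lp_structure_D h egD egD] .
      finally show ?thesis by (simp add: sat_comm_formula a_def)
    qed
    then show "\<exists>h b. lp_embedding h D D \<and> b \<in> carrier D \<and>
        (\<forall>\<alpha>. sat D ((h \<circ> a \<alpha> (f \<alpha>))(0 := b)) comm_formula)"
      using h b by blast
  qed
qed

text \<open>A common solution would equate the two right-hand sides. That equation no longer
  mentions \<open>x\<close>, so an elementary embedding reflects it to \<open>M\<close>.\<close>

lemma inconsistent_pair:
  assumes a: "assignment M a" "assignment M a'" and y1: "a 1 = a' 1"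
    and ne: "lp_comm M (a 2) (a 3) \<noteq> lp_comm M (a' 2) (a' 3)"
  shows "\<not> consistent_over M 0 {(comm_formula, a), (comm_formula, a')}"
proof
  assume "consistent_over M 0 {(comm_formula, a), (comm_formula, a')}"
  then obtain N :: "nat lp_struct" and h b where h: "elementary_embedding h M N"
    and "sat N ((h \<circ> a)(0 := b)) comm_formula" "sat N ((h \<circ> a')(0 := b)) comm_formula"
    unfolding consistent_over_def by auto
  then have eq: "lp_comm N (h (a 2)) (h (a 3)) = lp_comm N (h (a' 2)) (h (a' 3))"
    using y1 by (simp add: sat_comm_formula)
  \<comment> \<open>Variables 4 and 5 hold the second instance's parameters, so one formula under
    one assignment compares both commutators.\<close>
  define v where "v = a(4 := a' 2, 5 := a' 3)"
  let ?\<phi> = "Eq (Comm (Var 2) (Var 3)) (Comm (Var 4) (Var 5))"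
  have "assignment M v" using a by (simp add: v_def assignment_def)
  then have "sat N (h \<circ> v) ?\<phi> \<longleftrightarrow> sat M v ?\<phi>"
    using h by (simp only: elementary_embedding_def)
  moreover have "sat N (h \<circ> v) ?\<phi>" using eq by (simp add: v_def Comm_def lp_comm_def)
  ultimately show False using ne by (simp add: v_def Comm_def lp_comm_def)
qed


theorem proposition2p1:
  fixes p :: nat and D :: "'a lp_struct"
  assumes "prime p" and "p > 2"
    and "fraisse_limit (K2pP p) D"
  shows "has_TP2 (Th D) comm_formula 0"
proof -
  interpret fraisse_G2pP p D by unfold_locales (fact assms)+
  obtain a where a: "\<And>\<alpha> i. assignment D (a \<alpha> i)" "\<And>\<alpha> i j. a \<alpha> i 1 = a \<alpha> j 1"
    "\<And>\<alpha> i j. i \<noteq> j \<Longrightarrow> lp_comm D (a \<alpha> i 2) (a \<alpha> i 3) \<noteq> lp_comm D (a \<alpha> j 2) (a \<alpha> j 3)"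
    "\<And>f :: nat \<Rightarrow> nat. \<exists>h b. lp_embedding h D D \<and> b \<in> carrier D \<and>
       (\<forall>\<alpha>. sat D ((h \<circ> a \<alpha> (f \<alpha>))(0 := b)) comm_formula)"
    using exists_array[OF assms(2)] by blast
  \<comment> \<open>This copy of \<open>D\<close> serves both as the model carrying the array and as
    the elementary extension realising each path.\<close>
  obtain q and M :: "nat lp_struct" where M: "lp_structure M" and q: "lp_iso q D M"
    using countable_copy[OF lp_structure_D countable_D] .
  define r where "r = the_inv_into (carrier D) q"
  have r: "lp_iso r M D" unfolding r_def using lp_iso_inverse[OF q lp_structure_D] .
  have qe: "lp_embedding q D M" and re: "lp_embedding r M D"
    using q r by (auto simp: lp_iso_def)
  have qD: "q x \<in> carrier M" "r (q x) = x" if "x \<in> carrier D" for x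
    using qe that by (auto simp: lp_embedding_def r_def the_inv_into_f_f)
  have assn: "assignment D (r \<circ> v)" if "assignment M v" for v
    using re that by (auto simp: lp_embedding_def assignment_def)
  \<comment> \<open>Self-embeddings of \<open>D\<close> are conjugated by \<open>q\<close> into
    self-maps of \<open>M\<close>; \<open>r\<close> is its inverse, so elementarity transfers
    through \<open>sat_iso\<close> in both directions.\<close>
  have elem: "elementary_embedding (q \<circ> h \<circ> r) M M" if h: "lp_embedding h D D" for h
    unfolding elementary_embedding_def
  proof (intro conjI allI impI)
    show "(q \<circ> h \<circ> r) ` carrier M \<subseteq> carrier M"
      using lp_embedding_carrier[OF qe] lp_embedding_carrier[OF h] lp_embedding_carrier[OF re] by auto
    fix \<phi> v assume v: "assignment M v"
    have "elementary_embedding h D D"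
      using ultrahomogeneous_elementary[OF homogeneous lp_structure_D h] .
    then have "sat D (h \<circ> (r \<circ> v)) \<phi> \<longleftrightarrow> sat D (r \<circ> v) \<phi>"
      using assn[OF v] by (simp only: elementary_embedding_def)
    moreover have "assignment D (h \<circ> (r \<circ> v))"
      using assn[OF v] h by (auto simp: assignment_def lp_embedding_def)
    ultimately show "sat M (q \<circ> h \<circ> r \<circ> v) \<phi> \<longleftrightarrow> sat M v \<phi>"
      using sat_iso[OF lp_structure_D q, of "h \<circ> (r \<circ> v)" \<phi>] sat_iso[OF M r v, of \<phi>]
      by (simp only: comp_assoc)
  qed
  define c where "c \<alpha> i = q \<circ> a \<alpha> i" for \<alpha> i
  have c: "assignment M (c \<alpha> i)" for \<alpha> i
    using a(1)[of \<alpha> i] qD by (simp add: c_def assignment_def)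
  have "models M (Th D)"
    unfolding models_def
  proof (intro conjI ballI allI impI)
    fix \<phi> v assume "\<phi> \<in> Th D" "assignment M v"
    then show "sat M v \<phi>"
      using assn sat_iso[OF M r, of v \<phi>] by (simp only: Th_def mem_Collect_eq)
  qed (rule M)
  moreover have "k_inconsistent 2 M 0 (\<lambda>i. (comm_formula, c \<alpha> i))" for \<alpha>
    unfolding k_inconsistent_def
  proof (intro allI impI, elim conjE)
    fix I :: "nat set" assume "card I = 2"
    then obtain i j where I: "I = {i, j}" "i \<noteq> j" by (auto simp: card_2_iff)
    have aD: "a \<alpha> i n \<in> carrier D" for i n using a(1) by (simp add: assignment_def)
    have lc: "lp_comm D (a \<alpha> i 2) (a \<alpha> i 3) \<in> carrier D" for i
      using aD lp_structure_D by (simp add: lp_comm_def lp_structure_def)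
    have "lp_comm M (c \<alpha> i 2) (c \<alpha> i 3) \<noteq> lp_comm M (c \<alpha> j 2) (c \<alpha> j 3)"
      using a(3)[OF I(2), of \<alpha>] lp_comm_embedding[OF lp_structure_D qe aD aD] qD(2)[OF lc]
      by (simp add: c_def) metis
    then show "\<not> consistent_over M 0 ((\<lambda>i. (comm_formula, c \<alpha> i)) ` I)"
      using inconsistent_pair[OF c c, of \<alpha> i \<alpha> j] a(2)[of \<alpha> i j] by (simp add: I c_def)
  qed
  moreover have "consistent_over M 0 (range (\<lambda>\<alpha>. (comm_formula, c \<alpha> (f \<alpha>))))" for f
  proof -
    obtain h b where h: "lp_embedding h D D" and b: "b \<in> carrier D"
      and sat: "\<And>\<alpha>. sat D ((h \<circ> a \<alpha> (f \<alpha>))(0 := b)) comm_formula"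
      using a(4)[of f] by blast
    have "sat M (((q \<circ> h \<circ> r) \<circ> c \<alpha> (f \<alpha>))(0 := q b)) comm_formula" for \<alpha>
    proof -
      have aD: "a \<alpha> (f \<alpha>) n \<in> carrier D" for n using a(1) by (simp add: assignment_def)
      \<comment> \<open>The inner \<open>r\<close> cancels the \<open>q\<close> in \<open>c\<close>,
        so the assignment in \<open>M\<close> is the \<open>q\<close>-image of the one already
        satisfied in \<open>D\<close>.\<close>
      have "((q \<circ> h \<circ> r) \<circ> c \<alpha> (f \<alpha>))(0 := q b) = q \<circ> (h \<circ> a \<alpha> (f \<alpha>))(0 := b)"
        using qD(2)[OF aD] by (auto simp: c_def)
      moreover have "assignment D ((h \<circ> a \<alpha> (f \<alpha>))(0 := b))"
        using b h aD by (auto simp: assignment_def lp_embedding_def)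
      ultimately show ?thesis using sat sat_iso[OF lp_structure_D q] by metis
    qed
    then show ?thesis
      unfolding consistent_over_def using M elem[OF h] qD(1)[OF b] by blast
  qed
  ultimately show ?thesis
    unfolding has_TP2_def using c by blast
qed

end
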